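(* For $n\in\mathbb{N}$, $n\ge 1$, let $\mathsf{id}_n$ be the identity element of the sandpile group of $\mathsf{SG}_n$ with normal boundary conditions, and let $\mathsf{id}_n^{\triangle}:\mathsf{SG}\to\mathbb{R}$ be its piecewise constant continuation to the Sierpi\'nski gasket $\mathsf{SG}$. Then the sequence $(\mathsf{id}_n^{\triangle})_{n}$ converges in the weak* topology to the constant function $\mathsf{id}_{\mathsf{SG}}:\mathsf{SG}\to\mathbb{R}$, $x\mapsto \frac{8}{3}$; that is, for every $\mu$-measurable $C\subseteq \mathsf{SG}$, $\lim_{n\to\infty}\int_C \mathsf{id}_n^{\triangle}\,d\mu=\frac{8}{3}\mu(C)$.
   Context: Let $u_1=(0,0)$, $u_2=(1,0)$, $u_3=\frac12(1,\sqrt3)$ and $\psi_i(x)=\frac12(x-u_i)+u_i$ for $i\in\{1,2,3\}$. The Sierpi\'nski gasket $\mathsf{SG}$ is the unique nonempty compact set with $\mathsf{SG}=\bigcup_{i=1}^3\psi_i(\mathsf{SG})$. $\mathsf{SG}_0$ is the complete graph on $\{u_1,u_2,u_3\}$, and $\mathsf{SG}_n=\bigcup_{i=1}^3\psi_i(\mathsf{SG}_{n-1})$ (union of the images of vertices and edges, with coinciding vertices identified); its vertices are points of $\mathsf{SG}$, and $u_1,u_2,u_3$ are its corner vertices. For a word $w=(w_1,\dots,w_m)\in\{1,2,3\}^m$ put $\psi_w=\psi_{w_m}\circ\cdots\circ\psi_{w_1}$. $\mu$ is the Hausdorff (self-similar) probability measure on $\mathsf{SG}$ with $\mu(\psi_w(\mathsf{SG}))=3^{-|w|}$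 for all finite words $w$, defined on the $\sigma$-algebra generated by the sets $\psi_w(\mathsf{SG})$. Abelian sandpile model: for a finite connected graph with vertex set $V\cup\{s\}$ ($s$ the sink), a sandpile is $\eta:V\to\mathbb{N}$; it is stable if $\eta(v)<\deg(v)$ for all $v\in V$. Toppling at $v$ (legal if $\eta(v)\ge\deg(v)$) sends $\eta\mapsto \eta-\Delta\delta_v$, where $\Delta$ is the graph Laplacian ($\Delta(v,v)=\deg(v)$, $\Delta(v,w)=-(\text{number of edges between }v,w)$); $\eta^\circ$ denotes the unique stable configuration obtained by legal topplings. $\eta$ is recurrent if $\eta=(\eta_{\max}+\zeta)^\circ$ for some $\zeta:V\to\mathbb{N}$, where $\eta_{\max}(v)=\deg(v)-1$. The recurrent sandpiles with $\eta\oplus\zeta=(\eta+\zeta)^\circ$ form an abelian group (the sandpile group); its neutral element is the identity element. Normal boundary conditions on $\mathsf{SG}_n$: a new sink vertex $s$ is added and joined to each of the three corner vertices $u_1,u_2,u_3$ by two edges; $V$ is the vertex set of $\mathsf{SG}_n$. Piecewise constant continuation: for $f$ defined on the vertex set of $\mathsf{SG}_n$, $f^{\triangle}:\mathsf{SG}\to\mathbb{R}$ is defined by $f^{\triangle}(x)=f(v)$ where $v$ is the unique vertex of $\mathsf{SG}_n$ in the closed Euclidean ball $B(x,2^{-(n+1)})$ if there is exactly one such vertex, and $v$ is the one with smaller first coordinate if there are two (more than two cannot occur). Weak* convergence: $f_n\to f$ weak* means $\lim_n\int_C f_n\,d\mu=\int_C f\,d\mu$ for every measurable $C\subseteq\mathsf{SG}$.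 *)

theory Defs
  imports "HOL-Analysis.Analysis" "HOL-Algebra.Group"
begin

section \<open>The Sierpinski gasket and its graph approximations\<close>

text \<open>The plane is \<^typ>\<open>real \<times> real\<close>, whose metric is the Euclidean one. The index set
  is \<open>{1, 2, 3}\<close>.\<close>

definition corner :: "nat \<Rightarrow> real \<times> real" where
  "corner i = (if i = 1 then (0, 0) else if i = 2 then (1, 0) else (1/2) *\<^sub>R (1, sqrt 3))"

definition psi :: "nat \<Rightarrow> real \<times> real \<Rightarrow> real \<times> real" where
  "psi i x = (1/2) *\<^sub>R (x - corner i) + corner i"

definition SG :: "(real \<times> real) set" where
  "SG = (THE K. K \<noteq> {} \<and> compact K \<and> K = (\<Union>i\<in>{1,2,3}. psi i ` K))"

primrec SG_verts :: "nat \<Rightarrow> (real \<times> real) set" where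
  "SG_verts 0 = corner ` {1,2,3}"
| "SG_verts (Suc n) = (\<Union>i\<in>{1,2,3}. psi i ` SG_verts n)"

text \<open>Edges are two-element sets of points.\<close>

primrec SG_edges :: "nat \<Rightarrow> (real \<times> real) set set" where
  "SG_edges 0 = {{corner 1, corner 2}, {corner 1, corner 3}, {corner 2, corner 3}}"
| "SG_edges (Suc n) = (\<Union>i\<in>{1,2,3}. (`) (psi i) ` SG_edges n)"

text \<open>\<^const>\<open>fold\<close> applies the first letter first, so \<open>psi_word [w\<^sub>1, \<dots>, w\<^sub>m]\<close> is
  \<open>psi w\<^sub>m \<circ> \<dots> \<circ> psi w\<^sub>1\<close>.\<close>

definition psi_word :: "nat list \<Rightarrow> real \<times> real \<Rightarrow> real \<times> real" where
  "psi_word w = fold psi w"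

text \<open>\<^const>\<open>extend_measure\<close> yields the measure on the \<open>\<sigma>\<close>-algebra generated by the cells
  \<open>psi_word w ` SG\<close> that takes the prescribed values on them. Such a measure exists (the
  normalised Hausdorff measure) and is unique: distinct cells of equal level meet in at most
  one point, and points are null sets, so the cells determine it.\<close>

definition SG_measure :: "(real \<times> real) measure" where
  "SG_measure = extend_measure SG (lists {1,2,3}) (\<lambda>w. psi_word w ` SG)
                  (\<lambda>w. ennreal ((1/3) ^ length w))"

section \<open>Abelian sandpiles on a multigraph with a sink\<close>

text \<open>\<open>edge_mult G v w\<close> is the number of edges between \<open>v\<close> and \<open>w\<close>.\<close>

record 'a sink_graph =
  nonsink :: "'a set"
  sink :: 'a
  edge_mult :: "'a \<Rightarrow> 'a \<Rightarrow> nat"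

definition degree_of :: "'a sink_graph \<Rightarrow> 'a \<Rightarrow> nat" where
  "degree_of G v = (\<Sum>w\<in>insert (sink G) (nonsink G). edge_mult G v w)"

definition laplacian :: "'a sink_graph \<Rightarrow> 'a \<Rightarrow> 'a \<Rightarrow> int" where
  "laplacian G v w = (if v = w then int (degree_of G v) else - int (edge_mult G v w))"

text \<open>A sandpile is a function on the non-sink vertices; it is encoded as a total function
  that vanishes elsewhere.\<close>

definition sandpiles :: "'a sink_graph \<Rightarrow> ('a \<Rightarrow> nat) set" where
  "sandpiles G = {\<eta>. \<forall>v. v \<notin> nonsink G \<longrightarrow> \<eta> v = 0}"

definition stable :: "'a sink_graph \<Rightarrow> ('a \<Rightarrow> nat) \<Rightarrow> bool" where
  "stable G \<eta> \<longleftrightarrow> (\<forall>v\<in>nonsink G. \<eta> v < degree_of G v)"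

definition legal_toppling :: "'a sink_graph \<Rightarrow> ('a \<Rightarrow> nat) \<Rightarrow> ('a \<Rightarrow> nat) \<Rightarrow> bool" where
  "legal_toppling G \<eta> \<eta>' \<longleftrightarrow> \<eta> \<in> sandpiles G \<and> \<eta>' \<in> sandpiles G \<and>
     (\<exists>v\<in>nonsink G. \<eta> v \<ge> degree_of G v \<and>
        (\<forall>w\<in>nonsink G. int (\<eta>' w) = int (\<eta> w) - laplacian G w v))"

definition stabilization :: "'a sink_graph \<Rightarrow> ('a \<Rightarrow> nat) \<Rightarrow> ('a \<Rightarrow> nat)" where
  "stabilization G \<eta> = (THE \<eta>'. (legal_toppling G)\<^sup>*\<^sup>* \<eta> \<eta>' \<and> stable G \<eta>')"

definition max_stable :: "'a sink_graph \<Rightarrow> ('a \<Rightarrow> nat)" where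
  "max_stable G v = (if v \<in> nonsink G then degree_of G v - 1 else 0)"

definition sandpile_add :: "'a sink_graph \<Rightarrow> ('a \<Rightarrow> nat) \<Rightarrow> ('a \<Rightarrow> nat) \<Rightarrow> ('a \<Rightarrow> nat)" where
  "sandpile_add G \<eta> \<zeta> = stabilization G (\<lambda>v. \<eta> v + \<zeta> v)"

definition recurrent :: "'a sink_graph \<Rightarrow> ('a \<Rightarrow> nat) set" where
  "recurrent G = {\<eta>. \<exists>\<zeta>\<in>sandpiles G. \<eta> = stabilization G (\<lambda>v. max_stable G v + \<zeta> v)}"

definition sandpile_group :: "'a sink_graph \<Rightarrow> ('a \<Rightarrow> nat) monoid" where
  "sandpile_group G =
     \<lparr>carrier = recurrent G,
      monoid.mult = sandpile_add G,
      one = (THE e. e \<in> recurrent G \<and>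
               (\<forall>\<eta>\<in>recurrent G. sandpile_add G e \<eta> = \<eta> \<and> sandpile_add G \<eta> e = \<eta>))\<rparr>"

section \<open>Normal boundary conditions and the piecewise constant continuation\<close>

text \<open>The sink is \<^const>\<open>None\<close>; a vertex \<open>v\<close> of the gasket graph becomes \<open>Some v\<close>.\<close>

fun normal_mult :: "nat \<Rightarrow> (real \<times> real) option \<Rightarrow> (real \<times> real) option \<Rightarrow> nat" where
  "normal_mult n (Some v) (Some w) = (if {v, w} \<in> SG_edges n then 1 else 0)"
| "normal_mult n (Some v) None = (if v \<in> corner ` {1,2,3} then 2 else 0)"
| "normal_mult n None (Some w) = (if w \<in> corner ` {1,2,3} then 2 else 0)"
| "normal_mult n None None = 0"

definition SG_normal :: "nat \<Rightarrow> (real \<times> real) option sink_graph" where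
  "SG_normal n = \<lparr>nonsink = Some ` SG_verts n, sink = None, edge_mult = normal_mult n\<rparr>"

definition SG_id :: "nat \<Rightarrow> real \<times> real \<Rightarrow> nat" where
  "SG_id n v = \<one>\<^bsub>sandpile_group (SG_normal n)\<^esub> (Some v)"

definition near_verts :: "nat \<Rightarrow> real \<times> real \<Rightarrow> (real \<times> real) set" where
  "near_verts n x = SG_verts n \<inter> cball x ((1/2) ^ (n + 1))"

definition near_vert :: "nat \<Rightarrow> real \<times> real \<Rightarrow> real \<times> real" where
  "near_vert n x =
     (if \<exists>!v. v \<in> near_verts n x then THE v. v \<in> near_verts n x
      else THE v. v \<in> near_verts n x \<and> (\<forall>w\<in>near_verts n x. w \<noteq> v \<longrightarrow> fst v < fst w))"

definition continuation :: "nat \<Rightarrow> (real \<times> real \<Rightarrow> nat) \<Rightarrow> real \<times> real \<Rightarrow> real" where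
  "continuation n f x = real (f (near_vert n x))"

definition weak_star_converges ::
  "'a measure \<Rightarrow> (nat \<Rightarrow> 'a \<Rightarrow> real) \<Rightarrow> ('a \<Rightarrow> real) \<Rightarrow> bool" where
  "weak_star_converges M f g \<longleftrightarrow>
     (\<forall>C\<in>sets M. (\<lambda>n. set_lebesgue_integral M C (f n)) \<longlonglongrightarrow> set_lebesgue_integral M C g)"

end

theory Submission
  imports Defs
begin

text \<open>For \<open>n \<ge> 1\<close> the identity is explicit: on the level-one cell at the corner \<open>i\<close> it is 3 at every
  vertex that is the \<open>i\<close>-corner of some level-\<open>n\<close> cell inside it, except at the corner \<open>i\<close> of the
  gasket itself, and it is 2 elsewhere.
  It is recurrent, because fire started at the three corners burns each level-one cell row by row
  away from its corner. It is equivalent to zero, because it is the Laplacian of an integer function,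
  which is found by recursion over the cells (harmonic extension with a source term). A recurrent
  configuration equivalent to zero is the identity.

  Inside a cell of level \<open>m\<close> every level-\<open>n\<close> cell has one apex, and all but boundedly many apexes lie
  in two cells; so the three corner values of level-\<open>n\<close> cells add up to \<open>6 + 2 = 8\<close> on average,
  and their mean tends to \<open>8/3\<close>. Since the continuations are
  uniformly bounded, convergence on cells carries over to all measurable sets.\<close>

section \<open>Sandpiles\<close>

text \<open>The configuration is a sum over level-\<open>n\<close> cells: each puts 2 grains on its
  apex and 1 on each of its other two corners. A vertex in two cells thus gets 2 + 1 = 3 if it is
  the apex of one of them and 1 + 1 = 2 otherwise; a corner of the gasket lies in one cell only and
  gets 2, hence the exception there. The potential routes all grains of a level-one cell to its
  gasket corner, so the three level-one cells can be solved separately and glued. The obstacle is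
  integrality: harmonic extension divides by 5 at every level, so the corner values have to be
  prescribed modulo powers of 5. The potential \<open>f\<close> does double duty. Its Laplacian is
  \<open>e\<close>, which is at least 1, so multiples of \<open>f\<close> describe (possibly
  illegal) topplings that stabilise any sandpile. The least action principle bounds the legal
  topplings by them; this gives termination, and comparing the two counts identifies the
  stabilization.\<close>

definition lap_apply :: "'a sink_graph \<Rightarrow> ('a \<Rightarrow> int) \<Rightarrow> 'a \<Rightarrow> int" where
  "lap_apply G f v = (\<Sum>w\<in>nonsink G. laplacian G v w * f w)"

locale sink_multigraph =
  fixes G :: "'a sink_graph"
  assumes finite_nonsink: "finite (nonsink G)"
    and sink_notin: "sink G \<notin> nonsink G"
    and mult_sym: "edge_mult G v w = edge_mult G w v"
    and no_loops: "edge_mult G v v = 0"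
begin

lemma degree_eq: "degree_of G v = (\<Sum>w\<in>nonsink G. edge_mult G v w) + edge_mult G v (sink G)"
  by (simp add: degree_of_def finite_nonsink sink_notin)

lemma laplacian_sym: "laplacian G v w = laplacian G w v"
  by (auto simp: laplacian_def mult_sym)

text \<open>The sink behaves like a vertex of potential 0: \<open>degree_of\<close> counts its
  edges, but no potential is subtracted for it.\<close>

lemma lap_apply_eq:
  assumes "v \<in> nonsink G"
  shows "lap_apply G f v =
    (\<Sum>w\<in>nonsink G. int (edge_mult G v w) * (f v - f w)) + int (edge_mult G v (sink G)) * f v"
proof -
  have "lap_apply G f v = laplacian G v v * f v + (\<Sum>w\<in>nonsink G - {v}. laplacian G v w * f w)"
    unfolding lap_apply_def using assms by (simp add: sum.remove finite_nonsink)
  also have "(\<Sum>w\<in>nonsink G - {v}. laplacian G v w * f w)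
      = (\<Sum>w\<in>nonsink G - {v}. - (int (edge_mult G v w) * f w))"
    by (rule sum.cong) (auto simp: laplacian_def)
  also have "\<dots> = (\<Sum>w\<in>nonsink G. - (int (edge_mult G v w) * f w))"
    using assms by (subst sum.remove[OF finite_nonsink assms]) (simp add: no_loops)
  also have "laplacian G v v * f v
      = (\<Sum>w\<in>nonsink G. int (edge_mult G v w) * f v) + int (edge_mult G v (sink G)) * f v"
    by (simp add: laplacian_def degree_eq algebra_simps sum_distrib_left)
  finally show ?thesis
    by (simp add: algebra_simps sum.distrib sum_negf sum_subtractf)
qed

lemma lap_apply_diff: "lap_apply G (\<lambda>w. f w - g w) v = lap_apply G f v - lap_apply G g v"
  by (simp add: lap_apply_def algebra_simps sum_subtractf)

lemma lap_apply_add: "lap_apply G (\<lambda>w. f w + g w) v = lap_apply G f v + lap_apply G g v"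
  by (simp add: lap_apply_def algebra_simps sum.distrib)

lemma lap_apply_scale: "lap_apply G (\<lambda>w. c * f w) v = c * lap_apply G f v"
  by (simp add: lap_apply_def sum_distrib_left algebra_simps)

lemma lap_apply_single:
  assumes "v \<in> nonsink G"
  shows "lap_apply G (\<lambda>w. if w = v then 1 else 0) x = laplacian G x v"
  unfolding lap_apply_def using assms finite_nonsink
  by (simp add: if_distrib[of "\<lambda>t. _ * t"] cong: if_cong)

lemma sum_mult_lap_apply_sym:
  "(\<Sum>v\<in>nonsink G. g v * lap_apply G f v) = (\<Sum>v\<in>nonsink G. lap_apply G g v * f v)"
proof -
  have "(\<Sum>v\<in>nonsink G. g v * lap_apply G f v)
      = (\<Sum>v\<in>nonsink G. \<Sum>w\<in>nonsink G. g v * laplacian G v w * f w)"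
    by (simp add: lap_apply_def sum_distrib_left algebra_simps)
  also have "\<dots> = (\<Sum>w\<in>nonsink G. \<Sum>v\<in>nonsink G. g v * laplacian G v w * f w)"
    by (rule sum.swap)
  also have "\<dots> = (\<Sum>v\<in>nonsink G. lap_apply G g v * f v)"
    unfolding lap_apply_def sum_distrib_right
    by (intro sum.cong refl) (simp add: laplacian_sym mult.commute)
  finally show ?thesis .
qed

section \<open>Least action principle and uniqueness of the stabilization\<close>

lemma lap_apply_nonpos:
  assumes "v \<in> nonsink G" "h v = 0" "\<And>w. w \<in> nonsink G \<Longrightarrow> 0 \<le> h w"
  shows "lap_apply G h v \<le> 0"
  unfolding lap_apply_eq[OF assms(1)] using assms(2,3)
  by (auto intro!: sum_nonpos simp: mult_nonneg_nonpos)

lemma legal_topplingE: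
  assumes "legal_toppling G \<sigma> \<sigma>'"
  obtains v where "v \<in> nonsink G" "\<sigma> v \<ge> degree_of G v" "\<sigma> \<in> sandpiles G" "\<sigma>' \<in> sandpiles G"
    "\<And>w. w \<in> nonsink G \<Longrightarrow>
       int (\<sigma>' w) = int (\<sigma> w) - lap_apply G (\<lambda>x. if x = v then 1 else 0) w"
  using assms unfolding legal_toppling_def by (auto simp: lap_apply_single)

text \<open>A toppling count that brings \<sigma> below the degrees, whether or not its topplings
  are legal; the outcome may be negative, hence the integers.\<close>

definition stabilizing :: "('a \<Rightarrow> nat) \<Rightarrow> ('a \<Rightarrow> int) \<Rightarrow> bool" where
  "stabilizing \<sigma> h \<longleftrightarrow> (\<forall>v\<in>nonsink G. 0 \<le> h v \<and> int (\<sigma> v) - lap_apply G h v < int (degree_of G v))"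

text \<open>If \<open>h\<close> never toppled \<open>v\<close>, its other topplings could only add
  grains there, and \<open>v\<close> would stay unstable.\<close>

lemma stabilizing_unstable_pos:
  assumes "stabilizing \<sigma> h" "v \<in> nonsink G" "\<sigma> v \<ge> degree_of G v"
  shows "1 \<le> h v"
proof (rule ccontr)
  assume "\<not> 1 \<le> h v"
  then have "h v = 0" using assms by (auto simp: stabilizing_def dest: bspec[of _ _ v])
  then have "lap_apply G h v \<le> 0"
    using assms by (intro lap_apply_nonpos) (auto simp: stabilizing_def)
  then show False using assms by (auto simp: stabilizing_def dest!: bspec[of _ _ v])
qed

lemma stabilizing_topple:
  assumes "stabilizing \<sigma> h" "v \<in> nonsink G" "\<sigma> v \<ge> degree_of G v"
    "\<And>w. w \<in> nonsink G \<Longrightarrow>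
       int (\<sigma>' w) = int (\<sigma> w) - lap_apply G (\<lambda>x. if x = v then 1 else 0) w"
  shows "stabilizing \<sigma>' (\<lambda>w. h w - (if w = v then 1 else 0))"
  using assms stabilizing_unstable_pos[OF assms(1-3)]
  by (auto simp: stabilizing_def lap_apply_diff)

text \<open>Every legal toppling uses up one unit of \<open>h\<close>, so the sum of
  \<open>h\<close> bounds their number.\<close>

lemma stabilizing_ex_stable:
  assumes "stabilizing \<sigma> h" "\<sigma> \<in> sandpiles G"
  shows "\<exists>\<eta>. (legal_toppling G)\<^sup>*\<^sup>* \<sigma> \<eta> \<and> stable G \<eta>"
  using assms
proof (induction "nat (\<Sum>v\<in>nonsink G. h v)" arbitrary: \<sigma> h rule: less_induct)
  case less
  show ?case
  proof (cases "stable G \<sigma>")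
    case False
    then obtain v where v: "v \<in> nonsink G" "\<sigma> v \<ge> degree_of G v"
      by (auto simp: stable_def not_less)
    define \<sigma>' where "\<sigma>' = (\<lambda>w. if w \<in> nonsink G then nat (int (\<sigma> w) - laplacian G w v) else 0)"
    have nn: "int (\<sigma> w) - laplacian G w v \<ge> 0" for w
      using v by (auto simp: laplacian_def)
    have s': "\<sigma>' \<in> sandpiles G" by (simp add: \<sigma>'_def sandpiles_def)
    have leg: "legal_toppling G \<sigma> \<sigma>'"
      unfolding legal_toppling_def using v less.prems s' nn
      by (auto simp: \<sigma>'_def intro!: bexI[of _ v])
    have st: "stabilizing \<sigma>' (\<lambda>w. h w - (if w = v then 1 else 0))"
      using less.prems v nn by (intro stabilizing_topple[of \<sigma>])
        (auto simp: \<sigma>'_def lap_apply_single)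
    have pos: "1 \<le> h v" using stabilizing_unstable_pos[OF less.prems(1) v] .
    have "(\<Sum>w\<in>nonsink G. h w - (if w = v then 1 else 0)) = (\<Sum>w\<in>nonsink G. h w) - 1"
      using v finite_nonsink by (simp add: sum_subtractf)
    moreover have "h v \<le> (\<Sum>w\<in>nonsink G. h w)"
      using less.prems v finite_nonsink by (intro member_le_sum) (auto simp: stabilizing_def)
    ultimately obtain \<eta> where "(legal_toppling G)\<^sup>*\<^sup>* \<sigma>' \<eta>" "stable G \<eta>"
      using less.hyps[OF _ st s'] pos by auto
    then show ?thesis using leg by (meson converse_rtranclp_into_rtranclp)
  qed auto
qed

text \<open>\<open>u\<close> counts the topplings of the given legal sequence. Each of them hits an
  unstable vertex, where any stabilizing \<open>h\<close> has a unit left; removing that unit keeps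
  the rest stabilizing, so \<open>h\<close> dominates \<open>u\<close>.\<close>

lemma least_action:
  assumes "(legal_toppling G)\<^sup>*\<^sup>* \<sigma> \<eta>"
  obtains u where "\<And>v. 0 \<le> u v"
    "\<And>v. v \<in> nonsink G \<Longrightarrow> int (\<eta> v) = int (\<sigma> v) - lap_apply G u v"
    "\<And>h v. stabilizing \<sigma> h \<Longrightarrow> v \<in> nonsink G \<Longrightarrow> u v \<le> h v"
proof -
  have "\<exists>u. (\<forall>v. 0 \<le> u v) \<and> (\<forall>v\<in>nonsink G. int (\<eta> v) = int (\<sigma> v) - lap_apply G u v) \<and>
      (\<forall>h. stabilizing \<sigma> h \<longrightarrow> (\<forall>v\<in>nonsink G. u v \<le> h v))"
    using assms
  proof (induction rule: converse_rtranclp_induct)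
    case base
    show ?case by (rule exI[of _ "\<lambda>_. 0"]) (auto simp: lap_apply_def stabilizing_def)
  next
    case (step \<sigma> \<sigma>')
    then obtain u where u: "\<forall>v. 0 \<le> u v"
      "\<forall>v\<in>nonsink G. int (\<eta> v) = int (\<sigma>' v) - lap_apply G u v"
      "\<And>h. stabilizing \<sigma>' h \<Longrightarrow> \<forall>v\<in>nonsink G. u v \<le> h v" by blast
    from step(1) obtain v where v: "v \<in> nonsink G" "\<sigma> v \<ge> degree_of G v"
      "\<And>w. w \<in> nonsink G \<Longrightarrow>
         int (\<sigma>' w) = int (\<sigma> w) - lap_apply G (\<lambda>x. if x = v then 1 else 0) w"
      by (rule legal_topplingE) blast
    have "u w + (if w = v then 1 else 0) \<le> h w" if "stabilizing \<sigma> h" "w \<in> nonsink G" for h w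
      using u(3)[OF stabilizing_topple[OF that(1) v]] that(2) by force
    then show ?case using u v
      by (intro exI[of _ "\<lambda>w. u w + (if w = v then 1 else 0)"]) (auto simp: lap_apply_add)
  qed
  then show ?thesis using that by blast
qed

lemma least_action_bound:
  assumes "(legal_toppling G)\<^sup>*\<^sup>* \<sigma> \<eta>" "stabilizing \<sigma> h"
  shows "\<exists>u. \<forall>v\<in>nonsink G. int (\<eta> v) = int (\<sigma> v) - lap_apply G u v \<and> u v \<le> h v"
proof (rule least_action[OF assms(1)])
  fix u
  assume "\<And>v. v \<in> nonsink G \<Longrightarrow> int (\<eta> v) = int (\<sigma> v) - lap_apply G u v"
    "\<And>h v. stabilizing \<sigma> h \<Longrightarrow> v \<in> nonsink G \<Longrightarrow> u v \<le> h v"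
  then show ?thesis using assms(2) by (intro exI[of _ u]) simp
qed

lemma rtranclp_legal_sandpiles:
  assumes "(legal_toppling G)\<^sup>*\<^sup>* \<sigma> \<eta>" "\<sigma> \<in> sandpiles G"
  shows "\<eta> \<in> sandpiles G"
  using assms by (induction rule: rtranclp_induct) (auto simp: legal_toppling_def)

text \<open>The toppling counts of two legal sequences that end in stable configurations are
  stabilizing themselves, so each bounds the other.\<close>

lemma stable_unique:
  assumes "(legal_toppling G)\<^sup>*\<^sup>* \<sigma> \<eta>1" "stable G \<eta>1" "(legal_toppling G)\<^sup>*\<^sup>* \<sigma> \<eta>2" "stable G \<eta>2"
    "\<sigma> \<in> sandpiles G"
  shows "\<eta>1 = \<eta>2"
proof -
  from least_action[OF assms(1)] obtain u1 where u1: "\<And>v. 0 \<le> u1 v"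
    "\<And>v. v \<in> nonsink G \<Longrightarrow> int (\<eta>1 v) = int (\<sigma> v) - lap_apply G u1 v"
    "\<And>h v. stabilizing \<sigma> h \<Longrightarrow> v \<in> nonsink G \<Longrightarrow> u1 v \<le> h v" by blast
  from least_action[OF assms(3)] obtain u2 where u2: "\<And>v. 0 \<le> u2 v"
    "\<And>v. v \<in> nonsink G \<Longrightarrow> int (\<eta>2 v) = int (\<sigma> v) - lap_apply G u2 v"
    "\<And>h v. stabilizing \<sigma> h \<Longrightarrow> v \<in> nonsink G \<Longrightarrow> u2 v \<le> h v" by blast
  have "stabilizing \<sigma> u1" "stabilizing \<sigma> u2"
    using assms u1 u2 by (auto simp: stabilizing_def stable_def simp flip: u1(2) u2(2))
  then have eq: "v \<in> nonsink G \<Longrightarrow> u1 v = u2 v" for v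
    using u1(3) u2(3) by (meson order_antisym)
  have "lap_apply G u1 v = lap_apply G u2 v" for v
    unfolding lap_apply_def by (rule sum.cong) (auto simp: eq)
  then have "v \<in> nonsink G \<Longrightarrow> \<eta>1 v = \<eta>2 v" for v using u1(2) u2(2) by (metis of_nat_eq_iff)
  moreover have "\<eta>1 \<in> sandpiles G" "\<eta>2 \<in> sandpiles G"
    using assms rtranclp_legal_sandpiles by blast+
  ultimately show ?thesis unfolding sandpiles_def by (auto simp: fun_eq_iff) metis
qed

lemma stabilization_eqI:
  assumes "(legal_toppling G)\<^sup>*\<^sup>* \<sigma> \<eta>" "stable G \<eta>" "\<sigma> \<in> sandpiles G"
  shows "stabilization G \<sigma> = \<eta>"
  unfolding stabilization_def using assms by (blast intro: the_equality stable_unique)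

section \<open>Adding grains before or after toppling\<close>

lemma legal_toppling_add:
  assumes "legal_toppling G \<sigma> \<sigma>'" "\<zeta> \<in> sandpiles G"
  shows "legal_toppling G (\<lambda>v. \<sigma> v + \<zeta> v) (\<lambda>v. \<sigma>' v + \<zeta> v)"
proof -
  from assms(1) obtain v where v: "v \<in> nonsink G" "\<sigma> v \<ge> degree_of G v"
    "\<forall>w\<in>nonsink G. int (\<sigma>' w) = int (\<sigma> w) - laplacian G w v"
    and s: "\<sigma> \<in> sandpiles G" "\<sigma>' \<in> sandpiles G" by (auto simp: legal_toppling_def)
  show ?thesis
    unfolding legal_toppling_def using v s assms(2)
    by (intro conjI bexI[of _ v]) (auto simp: sandpiles_def)
qed

lemma rtranclp_legal_toppling_add:
  assumes "(legal_toppling G)\<^sup>*\<^sup>* \<sigma> \<sigma>'" "\<zeta> \<in> sandpiles G"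
  shows "(legal_toppling G)\<^sup>*\<^sup>* (\<lambda>v. \<sigma> v + \<zeta> v) (\<lambda>v. \<sigma>' v + \<zeta> v)"
  using assms(1)
proof (induction rule: rtranclp_induct)
  case (step y z)
  then show ?case using legal_toppling_add[OF _ assms(2)] by (meson rtranclp.rtrancl_into_rtrancl)
qed simp

lemma max_stable_sandpile: "max_stable G \<in> sandpiles G"
  by (simp add: max_stable_def sandpiles_def)

lemma sandpiles_add:
  "\<sigma> \<in> sandpiles G \<Longrightarrow> \<zeta> \<in> sandpiles G \<Longrightarrow> (\<lambda>v. \<sigma> v + \<zeta> v) \<in> sandpiles G"
  by (simp add: sandpiles_def)

end

text \<open>A certificate for \<open>e\<close> being the identity: \<open>lap_f\<close> makes it
  equivalent to zero, and \<open>no_forbidden\<close> is the burning criterion in the form that no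
  vertex set carries a forbidden subconfiguration.\<close>

locale sandpile_identity = sink_multigraph +
  fixes e :: "'a \<Rightarrow> nat" and f :: "'a \<Rightarrow> int"
  assumes e_sandpile: "e \<in> sandpiles G"
    and e_stable: "stable G e"
    and e_pos: "v \<in> nonsink G \<Longrightarrow> 1 \<le> e v"
    and f_nonneg: "v \<in> nonsink G \<Longrightarrow> 0 \<le> f v"
    and lap_f: "v \<in> nonsink G \<Longrightarrow> lap_apply G f v = int (e v)"
    and no_forbidden: "S \<subseteq> nonsink G \<Longrightarrow> S \<noteq> {} \<Longrightarrow> \<exists>v\<in>S. (\<Sum>w\<in>S. edge_mult G v w) \<le> e v"
begin

lemma degree_pos: "v \<in> nonsink G \<Longrightarrow> 0 < degree_of G v"
  using e_stable by (auto simp: stable_def)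

text \<open>Toppling by \<open>f\<close> removes \<open>e\<close>, hence at least one grain, at
  every vertex; after \<open>k\<close> rounds nothing positive is left of \<sigma>.\<close>

lemma stabilizing_scaled:
  assumes "\<And>v. v \<in> nonsink G \<Longrightarrow> \<sigma> v \<le> k"
  shows "stabilizing \<sigma> (\<lambda>v. int k * f v)"
proof -
  have "int (\<sigma> v) \<le> int k * int (e v)" if "v \<in> nonsink G" for v
    using assms[OF that] e_pos[OF that] mult_le_mono[of "\<sigma> v" k 1 "e v"]
    by (metis mult.right_neutral of_nat_mult zle_int)
  then show ?thesis
    unfolding stabilizing_def lap_apply_scale using degree_pos
    by (fastforce simp: lap_f f_nonneg)
qed

lemma stabilization_props:
  assumes "\<sigma> \<in> sandpiles G"
  shows "(legal_toppling G)\<^sup>*\<^sup>* \<sigma> (stabilization G \<sigma>)" "stable G (stabilization G \<sigma>)"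
    "stabilization G \<sigma> \<in> sandpiles G"
proof -
  have "\<sigma> v \<le> Max (\<sigma> ` nonsink G)" if "v \<in> nonsink G" for v
    using that finite_nonsink by auto
  then obtain \<eta> where \<eta>: "(legal_toppling G)\<^sup>*\<^sup>* \<sigma> \<eta>" "stable G \<eta>"
    using stabilizing_ex_stable[OF stabilizing_scaled assms] by blast
  then have "stabilization G \<sigma> = \<eta>" using assms by (rule stabilization_eqI)
  then show "(legal_toppling G)\<^sup>*\<^sup>* \<sigma> (stabilization G \<sigma>)" "stable G (stabilization G \<sigma>)"
    "stabilization G \<sigma> \<in> sandpiles G"
    using \<eta> rtranclp_legal_sandpiles assms by auto
qed

lemma stabilization_add:
  assumes "\<sigma> \<in> sandpiles G" "\<zeta> \<in> sandpiles G"
  shows "stabilization G (\<lambda>v. stabilization G \<sigma> v + \<zeta> v) = stabilization G (\<lambda>v. \<sigma> v + \<zeta> v)"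
proof -
  let ?\<tau> = "\<lambda>v. stabilization G \<sigma> v + \<zeta> v"
  have "?\<tau> \<in> sandpiles G" using assms stabilization_props by (auto simp: sandpiles_def)
  moreover have "(legal_toppling G)\<^sup>*\<^sup>* (\<lambda>v. \<sigma> v + \<zeta> v) ?\<tau>"
    by (rule rtranclp_legal_toppling_add) (use assms stabilization_props in auto)
  ultimately have "(legal_toppling G)\<^sup>*\<^sup>* (\<lambda>v. \<sigma> v + \<zeta> v) (stabilization G ?\<tau>)"
    using stabilization_props(1)[of ?\<tau>] by auto
  then show ?thesis
    using stabilization_eqI stabilization_props(2)[OF \<open>?\<tau> \<in> sandpiles G\<close>] sandpiles_add[OF assms]
    by metis
qed

text \<open>Symmetry of the Laplacian replaces the maximum principle:
  \<open>\<Sum> g \<le> \<Sum> g \<Delta>f = \<Sum> f \<Delta>g \<le> 0\<close>.\<close>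

lemma subharmonic_zero:
  assumes "\<And>v. v \<in> nonsink G \<Longrightarrow> 0 \<le> g v" "\<And>v. v \<in> nonsink G \<Longrightarrow> lap_apply G g v \<le> 0"
    "v \<in> nonsink G"
  shows "g v = 0"
proof -
  have "(\<Sum>v\<in>nonsink G. g v) \<le> (\<Sum>v\<in>nonsink G. g v * lap_apply G f v)"
  proof (rule sum_mono)
    fix v assume v: "v \<in> nonsink G"
    have "g v * 1 \<le> g v * int (e v)"
      using assms(1)[OF v] e_pos[OF v] by (intro mult_left_mono) auto
    then show "g v \<le> g v * lap_apply G f v" by (simp add: lap_f v)
  qed
  also have "\<dots> = (\<Sum>v\<in>nonsink G. lap_apply G g v * f v)" by (rule sum_mult_lap_apply_sym)
  also have "\<dots> \<le> 0" using assms f_nonneg by (intro sum_nonpos) (simp add: mult_nonpos_nonneg)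
  finally have "(\<Sum>v\<in>nonsink G. g v) = 0" using assms(1) by (meson order_antisym sum_nonneg)
  then show ?thesis using assms finite_nonsink by (simp add: sum_nonneg_eq_0_iff)
qed

text \<open>Toppling by \<open>f\<close> leads exactly to \<open>max_stable\<close>. The legal count
  \<open>u\<close> is at most \<open>f\<close>, and its result is \<open>max_stable\<close> plus the
  Laplacian of \<open>f - u\<close>; stability makes this Laplacian nonpositive, so
  \<open>f - u\<close> vanishes.\<close>

lemma stabilization_max_stable: "stabilization G (\<lambda>v. e v + max_stable G v) = max_stable G"
proof -
  let ?\<sigma> = "\<lambda>v. e v + max_stable G v"
  have s: "?\<sigma> \<in> sandpiles G" using e_sandpile max_stable_sandpile by (rule sandpiles_add)
  note st = stabilization_props[OF s]
  have mx: "int (max_stable G v) = int (degree_of G v) - 1" if "v \<in> nonsink G" for v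
    using degree_pos[OF that] that by (auto simp: max_stable_def)
  have "stabilizing ?\<sigma> f" by (auto simp: stabilizing_def f_nonneg lap_f mx)
  then obtain u where
    u2: "\<And>v. v \<in> nonsink G \<Longrightarrow> int (stabilization G ?\<sigma> v) = int (?\<sigma> v) - lap_apply G u v" and
    u3: "\<And>v. v \<in> nonsink G \<Longrightarrow> u v \<le> f v"
    using least_action_bound[OF st(1)] by metis
  have eq: "int (stabilization G ?\<sigma> v) = int (max_stable G v) + lap_apply G (\<lambda>w. f w - u w) v"
    if "v \<in> nonsink G" for v
    using u2[OF that] by (simp add: lap_apply_diff lap_f that)
  have le: "lap_apply G (\<lambda>w. f w - u w) v \<le> 0" if "v \<in> nonsink G" for v
    using eq[OF that] mx[OF that] st(2) that by (auto simp: stable_def dest: bspec[of _ _ v])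
  have "f v - u v = 0" if "v \<in> nonsink G" for v
    using subharmonic_zero[of "\<lambda>w. f w - u w"] le u3 that by auto
  then have "lap_apply G (\<lambda>w. f w - u w) v = 0" for v by (simp add: lap_apply_def)
  then have "stabilization G ?\<sigma> v = max_stable G v" for v
    using eq[of v] st(3) by (cases "v \<in> nonsink G") (auto simp: sandpiles_def max_stable_def)
  then show ?thesis by auto
qed

text \<open>On the set where a nonzero \<open>g\<close> is maximal, some vertex \<open>x\<close> has
  at most \<open>e x\<close> edges into the set. Each of its other edges, to lower vertices or to
  the sink, brings at least one grain, so \<open>x\<close> ends with at least its degree.\<close>

lemma stable_shift_zero:
  assumes "\<And>v. v \<in> nonsink G \<Longrightarrow> 0 \<le> g v"
    "\<And>v. v \<in> nonsink G \<Longrightarrow> int (e v) + lap_apply G g v < int (degree_of G v)" "v \<in> nonsink G"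
  shows "g v = 0"
proof (rule ccontr)
  assume "g v \<noteq> 0"
  define S where "S = {w \<in> nonsink G. g w = Max (g ` nonsink G)}"
  have max: "g w \<le> Max (g ` nonsink G)" if "w \<in> nonsink G" for w
    using that finite_nonsink by auto
  have pos: "1 \<le> Max (g ` nonsink G)"
    using max[OF assms(3)] assms(1)[OF assms(3)] \<open>g v \<noteq> 0\<close> by linarith
  have "Max (g ` nonsink G) \<in> g ` nonsink G" using assms(3) finite_nonsink by (intro Max_in) auto
  then have "S \<noteq> {}" by (auto simp: S_def)
  moreover have SV: "S \<subseteq> nonsink G" by (auto simp: S_def)
  ultimately obtain x where x: "x \<in> S" "(\<Sum>w\<in>S. edge_mult G x w) \<le> e x"
    using no_forbidden by blast
  have xV: "x \<in> nonsink G" using x SV by auto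
  have gx: "g x = Max (g ` nonsink G)" using x by (simp add: S_def)
  have "(\<Sum>w\<in>nonsink G. int (edge_mult G x w) * (if w \<in> S then 0 else 1))
      \<le> (\<Sum>w\<in>nonsink G. int (edge_mult G x w) * (g x - g w))"
  proof (rule sum_mono)
    fix w assume w: "w \<in> nonsink G"
    then have "(if w \<in> S then 0 else 1) \<le> g x - g w"
      using max[OF w] gx by (auto simp: S_def)
    then show "int (edge_mult G x w) * (if w \<in> S then 0 else 1) \<le> int (edge_mult G x w) * (g x - g w)"
      by (intro mult_left_mono) auto
  qed
  moreover have "(\<Sum>w\<in>nonsink G. int (edge_mult G x w))
      = (\<Sum>w\<in>nonsink G. int (edge_mult G x w) * (if w \<in> S then 0 else 1))
      + (\<Sum>w\<in>S. int (edge_mult G x w))"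
  proof -
    have "(\<Sum>w\<in>S. int (edge_mult G x w))
        = (\<Sum>w\<in>nonsink G. int (edge_mult G x w) * (if w \<in> S then 1 else 0))"
      using SV finite_nonsink
      by (simp add: if_distrib[of "\<lambda>t. _ * t"] sum.If_cases Int_absorb1 cong: if_cong)
    then show ?thesis by (auto simp flip: sum.distrib intro!: sum.cong)
  qed
  moreover have "int (edge_mult G x (sink G)) \<le> int (edge_mult G x (sink G)) * g x"
    using pos gx by (simp add: mult_le_cancel_left1)
  moreover have "(\<Sum>w\<in>S. int (edge_mult G x w)) \<le> int (e x)"
    using x(2) by (simp flip: of_nat_sum)
  ultimately have "int (degree_of G x) \<le> int (e x) + lap_apply G g x"
    unfolding lap_apply_eq[OF xV] degree_eq by simp
  then show False using assms(2)[OF xV] by simp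
qed

text \<open>Toppling \<open>k\<close> rounds of \<open>f\<close> leads from
  \<open>(k + 1) * e\<close> to \<open>e\<close>; the legal count cannot stop short of this by
  \<open>stable_shift_zero\<close>. With \<open>k\<close> the largest value of
  \<open>max_stable\<close>, the multiple lies above \<open>max_stable\<close>, and the difference
  serves as the added sandpile.\<close>

lemma e_recurrent: "e \<in> recurrent G"
proof -
  define k where "k = Max (max_stable G ` nonsink G)"
  let ?\<sigma> = "\<lambda>v. (k + 1) * e v"
  have s: "?\<sigma> \<in> sandpiles G" using e_sandpile by (auto simp: sandpiles_def)
  note st = stabilization_props[OF s]
  have "stabilizing ?\<sigma> (\<lambda>v. int k * f v)"
    using e_stable by (auto simp: stabilizing_def f_nonneg lap_apply_scale lap_f stable_def algebra_simps)
  then obtain u where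
    u2: "\<And>v. v \<in> nonsink G \<Longrightarrow> int (stabilization G ?\<sigma> v) = int (?\<sigma> v) - lap_apply G u v" and
    u3: "\<And>v. v \<in> nonsink G \<Longrightarrow> u v \<le> int k * f v"
    using least_action_bound[OF st(1)] by metis
  have eq: "int (stabilization G ?\<sigma> v) = int (e v) + lap_apply G (\<lambda>w. int k * f w - u w) v"
    if "v \<in> nonsink G" for v
    using u2[OF that] by (simp add: lap_apply_diff lap_apply_scale lap_f that algebra_simps)
  have "int k * f v - u v = 0" if "v \<in> nonsink G" for v
    using stable_shift_zero[of "\<lambda>w. int k * f w - u w"] that u3 st(2)
    by (auto simp: stable_def simp flip: eq)
  then have "lap_apply G (\<lambda>w. int k * f w - u w) v = 0" for v by (simp add: lap_apply_def)
  then have "stabilization G ?\<sigma> v = e v" for v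
    using eq[of v] st(3) e_sandpile by (cases "v \<in> nonsink G") (auto simp: sandpiles_def)
  then have se: "stabilization G ?\<sigma> = e" by auto
  have le: "max_stable G v \<le> ?\<sigma> v" for v
  proof (cases "v \<in> nonsink G")
    case True
    then have "max_stable G v \<le> k" using finite_nonsink by (auto simp: k_def)
    also have "k \<le> (k + 1) * 1" by simp
    also have "\<dots> \<le> ?\<sigma> v" using e_pos[OF True] by (intro mult_left_mono) auto
    finally show ?thesis .
  qed (simp add: max_stable_def)
  have "(\<lambda>v. ?\<sigma> v - max_stable G v) \<in> sandpiles G" using s by (auto simp: sandpiles_def)
  moreover have "e = stabilization G (\<lambda>v. max_stable G v + (?\<sigma> v - max_stable G v))"
    using se le by simp
  ultimately show ?thesis
    unfolding recurrent_def mem_Collect_eq by (intro bexI[where x = "\<lambda>v. ?\<sigma> v - max_stable G v"])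
qed

text \<open>A recurrent configuration arises from \<open>max_stable\<close> by adding grains, and
  \<open>max_stable\<close> already absorbs \<open>e\<close>.\<close>

lemma sandpile_add_e:
  assumes "\<eta> \<in> recurrent G"
  shows "sandpile_add G e \<eta> = \<eta>" "sandpile_add G \<eta> e = \<eta>"
proof -
  from assms obtain \<zeta> where z: "\<zeta> \<in> sandpiles G"
    "\<eta> = stabilization G (\<lambda>v. max_stable G v + \<zeta> v)" by (auto simp: recurrent_def)
  have "sandpile_add G \<eta> e = stabilization G (\<lambda>v. (e v + max_stable G v) + \<zeta> v)"
    unfolding sandpile_add_def z(2)
    by (subst stabilization_add) (auto simp: z(1) e_sandpile max_stable_sandpile sandpiles_add algebra_simps)
  also have "\<dots> = \<eta>"
    by (subst stabilization_add[symmetric])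
       (auto simp: z e_sandpile max_stable_sandpile sandpiles_add stabilization_max_stable)
  finally show "sandpile_add G \<eta> e = \<eta>" .
  then show "sandpile_add G e \<eta> = \<eta>" by (simp add: sandpile_add_def add.commute)
qed

theorem one_sandpile_group: "\<one>\<^bsub>sandpile_group G\<^esub> = e"
proof -
  have "(THE e. e \<in> recurrent G \<and>
      (\<forall>\<eta>\<in>recurrent G. sandpile_add G e \<eta> = \<eta> \<and> sandpile_add G \<eta> e = \<eta>)) = e"
  proof (rule the_equality)
    show "e \<in> recurrent G \<and> (\<forall>\<eta>\<in>recurrent G. sandpile_add G e \<eta> = \<eta> \<and> sandpile_add G \<eta> e = \<eta>)"
      using e_recurrent sandpile_add_e by blast
  next
    fix e' assume "e' \<in> recurrent G \<and>
      (\<forall>\<eta>\<in>recurrent G. sandpile_add G e' \<eta> = \<eta> \<and> sandpile_add G \<eta> e' = \<eta>)"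
    then show "e' = e" using e_recurrent sandpile_add_e by metis
  qed
  then show ?thesis by (simp add: sandpile_group_def)
qed

end

section \<open>Barycentric coordinates and vertices\<close>

lemma psi_inj: "inj (psi i)"
  by (auto simp: inj_def psi_def)

definition psi_inv :: "nat \<Rightarrow> real \<times> real \<Rightarrow> real \<times> real" where
  "psi_inv i x = 2 *\<^sub>R x - corner i"

lemma psi_psi_inv [simp]: "psi i (psi_inv i x) = x"
  by (simp add: psi_def psi_inv_def prod_eq_iff field_simps)

lemma psi_inv_psi [simp]: "psi_inv i (psi i x) = x"
  by (simp add: psi_def psi_inv_def prod_eq_iff field_simps)

definition bary :: "nat \<Rightarrow> real \<times> real \<Rightarrow> real" where
  "bary k p = (if k = 1 then 1 - fst p - snd p / sqrt 3
     else if k = 2 then fst p - snd p / sqrt 3 else 2 * snd p / sqrt 3)"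

lemma bary_sum: "bary 1 x + bary 2 x + bary 3 x = 1"
  by (simp add: bary_def)

lemma bary_eqI:
  assumes "\<And>k. k \<in> {1,2,3} \<Longrightarrow> bary k x = bary k y"
  shows "x = y"
  using assms[of 2] assms[of 3] by (auto simp: bary_def prod_eq_iff)

lemma bary_corner:
  assumes "i \<in> {1,2,3}" "k \<in> {1,2,3}"
  shows "bary k (corner i) = (if k = i then 1 else 0)"
  using assms by (auto simp: bary_def corner_def)

lemma bary_psi:
  assumes "i \<in> {1,2,3}" "k \<in> {1,2,3}"
  shows "bary k (psi i x) = (bary k x + (if k = i then 1 else 0)) / 2"
  using assms by (auto simp: bary_def corner_def psi_def field_simps)

lemma bary_psi_inv:
  assumes "i \<in> {1,2,3}" "k \<in> {1,2,3}"
  shows "bary k (psi_inv i x) = 2 * bary k x - (if k = i then 1 else 0)"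
  using bary_psi[OF assms, of "psi_inv i x"] by auto

lemma corner_eq_iff:
  assumes "i \<in> {1,2,3}" "k \<in> {1,2,3}"
  shows "corner i = corner k \<longleftrightarrow> i = k"
  using assms bary_corner[of i k] bary_corner[of k k] by auto

lemma psi_corner_self [simp]: "psi i (corner i) = corner i"
  by (simp add: psi_def)

lemma psi_corner_swap: "psi i (corner k) = psi k (corner i)"
  by (simp add: psi_def prod_eq_iff field_simps)

definition base_triangle :: "(real \<times> real) set" where
  "base_triangle = {x. \<forall>k\<in>{1,2,3}. 0 \<le> bary k x}"

lemma triangleD: "x \<in> base_triangle \<Longrightarrow> k \<in> {1,2,3} \<Longrightarrow> 0 \<le> bary k x"
  unfolding base_triangle_def mem_Collect_eq by (rule bspec)

lemma corner_triangle: "i \<in> {1,2,3} \<Longrightarrow> corner i \<in> base_triangle"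
  unfolding base_triangle_def mem_Collect_eq using bary_corner[of i] by (intro ballI) simp

lemma psi_triangle:
  assumes "i \<in> {1,2,3}" "x \<in> base_triangle"
  shows "psi i x \<in> base_triangle"
  unfolding base_triangle_def mem_Collect_eq
proof
  fix k :: nat assume k: "k \<in> {1,2,3}"
  show "0 \<le> bary k (psi i x)"
    unfolding bary_psi[OF assms(1) k] using triangleD[OF assms(2) k] by auto
qed

lemma bary_ge_one:
  assumes "x \<in> base_triangle" "i \<in> {1,2,3}" "1 \<le> bary i x"
  shows "x = corner i"
proof (rule bary_eqI)
  fix k :: nat assume k: "k \<in> {1,2,3}"
  note t = triangleD[OF assms(1), of 1] triangleD[OF assms(1), of 2] triangleD[OF assms(1), of 3]
  show "bary k x = bary k (corner i)"
    unfolding bary_corner[OF assms(2) k] using assms(2,3) k t bary_sum[of x] by auto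
qed

text \<open>Comparing the \<open>i\<close>-th coordinates gives
  \<open>bary i y = bary i x + 1\<close>, which inside the triangle happens only at corners. So two
  level-one cells meet in one point, the midpoint of a side.\<close>

lemma psi_eq_psi_imp_corner:
  assumes "i \<in> {1,2,3}" "k \<in> {1,2,3}" "i \<noteq> k" "x \<in> base_triangle" "y \<in> base_triangle" "psi i x = psi k y"
  shows "x = corner k" "y = corner i"
proof -
  have "bary i (psi i x) = bary i (psi k y)" "bary k (psi i x) = bary k (psi k y)"
    using assms by auto
  then have "bary i y = bary i x + 1" "bary k x = bary k y + 1"
    using assms(1-3) by (simp_all add: bary_psi del: insert_iff)
  then show "x = corner k" "y = corner i"
    using assms triangleD[OF assms(4,1)] triangleD[OF assms(5,2)] by (auto intro!: bary_ge_one)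
qed

lemma psi_eq_corner_imp:
  assumes "psi i x \<in> corner ` {1,2,3}" "i \<in> {1,2,3}" "x \<in> base_triangle"
  shows "x = corner i"
proof -
  from assms(1) obtain k where k: "k \<in> {1,2,3}" "psi i x = psi k (corner k)" by auto
  show ?thesis
  proof (cases "i = k")
    case True
    then show ?thesis using k injD[OF psi_inj, of i x "corner k"] by simp
  next
    case False
    have "corner k = corner i"
      by (rule psi_eq_psi_imp_corner(2)[OF assms(2) k(1) False assms(3) corner_triangle[OF k(1)] k(2)])
    then show ?thesis using False corner_eq_iff[OF k(1) assms(2)] by simp
  qed
qed

lemma SG_verts_triangle: "SG_verts j \<subseteq> base_triangle"
proof (induction j)
  case 0
  show ?case using corner_triangle by auto
next
  case (Suc j)
  then show ?case using psi_triangle by (auto 0 3)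
qed

lemma finite_SG_verts: "finite (SG_verts j)"
  by (induction j) auto

lemma corner_SG_verts: "i \<in> {1,2,3} \<Longrightarrow> corner i \<in> SG_verts j"
proof (induction j)
  case (Suc j)
  then have "psi i (corner i) \<in> SG_verts (Suc j)" unfolding SG_verts.simps by blast
  then show ?case by simp
qed auto

lemma psi_SG_verts: "i \<in> {1,2,3} \<Longrightarrow> x \<in> SG_verts j \<Longrightarrow> psi i x \<in> SG_verts (Suc j)"
  unfolding SG_verts.simps by blast

text \<open>The cases differ in the number of level-one cells around the vertex: two at a midpoint,
  one otherwise. The recursions for degrees, higher neighbours and Laplacians use this
  split.\<close>

lemma SG_verts_SucE:
  assumes "v \<in> SG_verts (Suc j)"
  obtains (corner) i where "i \<in> {1,2,3}" "v = corner i"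
  | (mid) i k where "i \<in> {1,2,3}" "k \<in> {1,2,3}" "i \<noteq> k" "v = psi i (corner k)"
  | (inner) i x where "i \<in> {1,2,3}" "x \<in> SG_verts j" "x \<notin> corner ` {1,2,3}" "v = psi i x"
proof -
  from assms obtain i x where ix: "i \<in> {1,2,3}" "x \<in> SG_verts j" "v = psi i x"
    unfolding SG_verts.simps by blast
  show ?thesis
  proof (cases "x \<in> corner ` {1,2,3}")
    case True
    then obtain k where "k \<in> {1,2,3}" "x = corner k" by blast
    then show ?thesis using ix corner mid by (cases "i = k") auto
  qed (use ix inner in blast)
qed

section \<open>Neighbourhoods\<close>

definition nbrs :: "nat \<Rightarrow> real \<times> real \<Rightarrow> (real \<times> real) set" where
  "nbrs j v = {w. {v, w} \<in> SG_edges j}"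

lemma SG_edgesE:
  assumes "E \<in> SG_edges j"
  obtains a b where "E = {a, b}" "a \<noteq> b" "a \<in> SG_verts j" "b \<in> SG_verts j"
proof -
  have "\<exists>a b. E = {a, b} \<and> a \<noteq> b \<and> a \<in> SG_verts j \<and> b \<in> SG_verts j"
    using assms
  proof (induction j arbitrary: E)
    case 0
    have "corner 1 \<noteq> corner 2" "corner 1 \<noteq> corner 3" "corner 2 \<noteq> corner 3"
      by (simp_all add: corner_eq_iff)
    with 0 show ?case unfolding SG_edges.simps SG_verts.simps by blast
  next
    case (Suc j)
    then obtain i E' where i: "i \<in> {1,2,3}" "E' \<in> SG_edges j" "E = psi i ` E'"
      unfolding SG_edges.simps by blast
    with Suc.IH obtain a b where "E' = {a, b}" "a \<noteq> b" "a \<in> SG_verts j" "b \<in> SG_verts j" by blast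
    then show ?case using i psi_SG_verts[OF i(1)] psi_inj[of i]
      by (intro exI[of _ "psi i a"] exI[of _ "psi i b"]) (auto simp: inj_eq)
  qed
  then show ?thesis using that by blast
qed

lemma nbrsD: "w \<in> nbrs j v \<Longrightarrow> v \<in> SG_verts j \<and> w \<in> SG_verts j \<and> w \<noteq> v"
  unfolding nbrs_def mem_Collect_eq by (erule SG_edgesE) (auto simp: doubleton_eq_iff)

lemma nbrs_empty: "v \<notin> SG_verts j \<Longrightarrow> nbrs j v = {}"
  using nbrsD by blast

lemma finite_nbrs: "finite (nbrs j v)"
  by (rule finite_subset[OF _ finite_SG_verts[of j]]) (use nbrsD in blast)

lemma other_two:
  assumes "t \<in> {1, 2, 3 :: nat}"
  obtains l r where "distinct [t, l, r]" "{t, l, r} = {1, 2, 3}"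
proof -
  from assms consider "t = 1" | "t = 2" | "t = 3" by blast
  then show ?thesis
  proof cases
    case 1 then show ?thesis by (intro that[of 2 3]) auto
  next
    case 2 then show ?thesis by (intro that[of 1 3]) auto
  next
    case 3 then show ?thesis by (intro that[of 1 2]) auto
  qed
qed

lemma nbrs_0:
  assumes "distinct [t, l, r]" "{t, l, r} = {1, 2, 3}"
  shows "nbrs 0 (corner t) = {corner l, corner r}"
proof -
  have t: "t \<in> {1,2,3}" "l \<in> {1,2,3}" "r \<in> {1,2,3}" using assms(2) by blast+
  have "corner 1 \<noteq> corner 2" "corner 1 \<noteq> corner 3" "corner 2 \<noteq> corner 3"
    by (simp_all add: corner_eq_iff)
  then show ?thesis
    using t assms(1) unfolding nbrs_def SG_edges.simps
    by (auto simp: doubleton_eq_iff insert_commute)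
qed

lemma doubleton_in_image_psi:
  "{v, w} \<in> (`) (psi i) ` \<E> \<longleftrightarrow> {psi_inv i v, psi_inv i w} \<in> \<E>"
proof -
  have "inj ((`) (psi i))" using psi_inj by (simp add: inj_image_eq_iff inj_on_def)
  moreover have "{v, w} = psi i ` {psi_inv i v, psi_inv i w}" by simp
  ultimately show ?thesis by (metis inj_image_mem_iff)
qed

lemma nbrs_Suc: "nbrs (Suc j) v = (\<Union>i\<in>{1,2,3}. psi i ` nbrs j (psi_inv i v))"
proof -
  have "w \<in> psi i ` nbrs j (psi_inv i v) \<longleftrightarrow> {v, w} \<in> (`) (psi i) ` SG_edges j" for i w
    unfolding doubleton_in_image_psi nbrs_def
    by (metis (no_types, lifting) image_iff mem_Collect_eq psi_inv_psi psi_psi_inv)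
  then show ?thesis
    unfolding nbrs_def[of "Suc j"] SG_edges.simps by (simp only: set_eq_iff mem_Collect_eq UN_iff) simp
qed

text \<open>A neighbour of \<open>v\<close> through both cells would, like \<open>v\<close>, be
  their only common point, but neighbours are distinct.\<close>

lemma nbrs_psi_disjoint:
  assumes "i \<in> {1,2,3}" "k \<in> {1,2,3}" "i \<noteq> k"
  shows "psi i ` nbrs j (psi_inv i v) \<inter> psi k ` nbrs j (psi_inv k v) = {}"
proof (rule ccontr)
  assume "\<not> ?thesis"
  then obtain x y where xy: "x \<in> nbrs j (psi_inv i v)" "y \<in> nbrs j (psi_inv k v)" "psi i x = psi k y"
    by blast
  have "x = corner k"
    using assms xy SG_verts_triangle[of j] by (intro psi_eq_psi_imp_corner[of i k x y]) (auto dest!: nbrsD)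
  moreover have "psi_inv i v = corner k"
    using assms xy SG_verts_triangle[of j]
    by (intro psi_eq_psi_imp_corner[of i k "psi_inv i v" "psi_inv k v"]) (auto dest!: nbrsD)
  ultimately show False using nbrsD[OF xy(1)] by simp
qed

lemma sum_nbrs_Suc:
  "sum g (nbrs (Suc j) v) = (\<Sum>i\<in>{1,2,3}. \<Sum>w\<in>nbrs j (psi_inv i v). g (psi i w))"
proof -
  have "sum g (nbrs (Suc j) v) = (\<Sum>i\<in>{1,2,3}. sum g (psi i ` nbrs j (psi_inv i v)))"
    unfolding nbrs_Suc
    by (rule sum.UNION_disjoint) (use finite_nbrs nbrs_psi_disjoint in auto)
  also have "\<dots> = (\<Sum>i\<in>{1,2,3}. \<Sum>w\<in>nbrs j (psi_inv i v). g (psi i w))"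
    by (intro sum.cong refl sum.reindex_cong[of "psi _"]) (auto intro: inj_on_subset[OF psi_inj])
  finally show ?thesis .
qed

lemma psi_inv_corner_notin:
  assumes "i \<in> {1,2,3}" "k \<in> {1,2,3}" "i \<noteq> k"
  shows "psi_inv k (corner i) \<notin> SG_verts j"
proof
  assume "psi_inv k (corner i) \<in> SG_verts j"
  then have "0 \<le> bary k (psi_inv k (corner i))" using SG_verts_triangle triangleD assms by blast
  then show False using assms by (simp add: bary_psi_inv bary_corner del: insert_iff)
qed

lemma psi_inv_psi_notin:
  assumes "i \<in> {1,2,3}" "k \<in> {1,2,3}" "i \<noteq> k" "x \<in> SG_verts j" "x \<noteq> corner k"
  shows "psi_inv k (psi i x) \<notin> SG_verts j"
proof
  assume "psi_inv k (psi i x) \<in> SG_verts j"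
  then have "x = corner k"
    using assms SG_verts_triangle by (intro psi_eq_psi_imp_corner[of i k x "psi_inv k (psi i x)"]) auto
  then show False using assms by simp
qed

text \<open>This lemma and the next two localise quantities that are additive over level-one cells.
  \<open>H i\<close> is the contribution of cell \<open>i\<close>, pulled back by
  \<open>psi_inv i\<close>; cells that miss the point drop out because its preimage is not a
  vertex.\<close>

lemma local_sum_corner:
  fixes H :: "nat \<Rightarrow> real \<times> real \<Rightarrow> 'b::comm_monoid_add"
  assumes "\<And>i x. x \<notin> SG_verts j \<Longrightarrow> H i x = 0" "i \<in> {1,2,3}"
  shows "(\<Sum>m\<in>{1,2,3}. H m (psi_inv m (corner i))) = H i (corner i)"
proof -
  have "(\<Sum>m\<in>{1,2,3}. H m (psi_inv m (corner i))) = (\<Sum>m\<in>{i}. H m (psi_inv m (corner i)))"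
    using assms psi_inv_corner_notin[OF assms(2)] by (intro sum.mono_neutral_right) auto
  then show ?thesis using psi_inv_psi[of i "corner i"] by simp
qed

lemma local_sum_inner:
  fixes H :: "nat \<Rightarrow> real \<times> real \<Rightarrow> 'b::comm_monoid_add"
  assumes "\<And>i x. x \<notin> SG_verts j \<Longrightarrow> H i x = 0" "i \<in> {1,2,3}" "x \<in> SG_verts j" "x \<notin> corner ` {1,2,3}"
  shows "(\<Sum>m\<in>{1,2,3}. H m (psi_inv m (psi i x))) = H i x"
proof -
  have "psi_inv m (psi i x) \<notin> SG_verts j" if "m \<in> {1,2,3}" "m \<noteq> i" for m
    using assms that by (intro psi_inv_psi_notin) auto
  then have "(\<Sum>m\<in>{1,2,3}. H m (psi_inv m (psi i x))) = (\<Sum>m\<in>{i}. H m (psi_inv m (psi i x)))"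
    using assms by (intro sum.mono_neutral_right) auto
  then show ?thesis by simp
qed

lemma local_sum_mid:
  fixes H :: "nat \<Rightarrow> real \<times> real \<Rightarrow> 'b::comm_monoid_add"
  assumes "\<And>i x. x \<notin> SG_verts j \<Longrightarrow> H i x = 0" "i \<in> {1,2,3}" "k \<in> {1,2,3}" "i \<noteq> k"
  shows "(\<Sum>m\<in>{1,2,3}. H m (psi_inv m (psi i (corner k)))) = H i (corner k) + H k (corner i)"
proof -
  have "psi_inv m (psi i (corner k)) \<notin> SG_verts j" if "m \<in> {1,2,3}" "m \<noteq> i" "m \<noteq> k" for m
    using assms that corner_eq_iff[of k m] corner_SG_verts by (intro psi_inv_psi_notin) auto
  then have "(\<Sum>m\<in>{1,2,3}. H m (psi_inv m (psi i (corner k))))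
      = (\<Sum>m\<in>{i,k}. H m (psi_inv m (psi i (corner k))))"
    using assms by (intro sum.mono_neutral_right) auto
  moreover have "psi_inv k (psi i (corner k)) = corner i" by (subst psi_corner_swap) simp
  ultimately show ?thesis using assms by simp
qed

lemma psi_corner_notin:
  assumes "i \<in> {1,2,3}" "k \<in> {1,2,3}" "i \<noteq> k"
  shows "psi i (corner k) \<notin> corner ` {1,2,3}"
  using assms(3) psi_eq_corner_imp[OF _ assms(1) corner_triangle[OF assms(2)]] corner_eq_iff[OF assms(2,1)]
  by auto

lemma psi_inner_notin:
  assumes "i \<in> {1,2,3}" "x \<in> SG_verts j" "x \<notin> corner ` {1,2,3}"
  shows "psi i x \<notin> corner ` {1,2,3}"
  using assms(2,3) psi_eq_corner_imp[OF _ assms(1), of x] SG_verts_triangle imageI[OF assms(1), of corner]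
  by (metis subsetD)

section \<open>Vertex degrees\<close>

lemma card_nbrs_Suc: "card (nbrs (Suc j) v) = (\<Sum>i\<in>{1,2,3}. card (nbrs j (psi_inv i v)))"
  unfolding card_eq_sum by (rule sum_nbrs_Suc)

lemma card_nbrs_corner:
  assumes "i \<in> {1,2,3}"
  shows "card (nbrs j (corner i)) = 2"
proof (induction j)
  case 0
  obtain l r where lr: "distinct [i, l, r]" "{i, l, r} = {1, 2, 3}"
    using assms by (rule other_two)
  then have "l \<in> {1,2,3}" "r \<in> {1,2,3}" by blast+
  then show ?case using nbrs_0[OF lr] lr corner_eq_iff[of l r] by simp
next
  case (Suc j)
  have "card (nbrs (Suc j) (corner i)) = card (nbrs j (corner i))"
    unfolding card_nbrs_Suc using assms by (intro local_sum_corner[where j = j]) (simp_all add: nbrs_empty)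
  then show ?case using Suc by simp
qed

lemma card_nbrs_noncorner:
  assumes "v \<in> SG_verts j" "v \<notin> corner ` {1,2,3}"
  shows "card (nbrs j v) = 4"
  using assms
proof (induction j arbitrary: v)
  case (Suc j)
  from Suc.prems(1) show ?case
  proof (cases rule: SG_verts_SucE)
    case (corner i)
    then show ?thesis using Suc.prems(2) by blast
  next
    case (mid i k)
    have "card (nbrs (Suc j) v) = card (nbrs j (corner k)) + card (nbrs j (corner i))"
      unfolding card_nbrs_Suc mid(4) using mid(1-3) by (intro local_sum_mid[where j = j]) (simp_all add: nbrs_empty)
    then show ?thesis using card_nbrs_corner[OF mid(1)] card_nbrs_corner[OF mid(2)] by simp
  next
    case (inner i x)
    have "card (nbrs (Suc j) v) = card (nbrs j x)"
      unfolding card_nbrs_Suc inner(4) using inner(1-3)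
      by (intro local_sum_inner[where j = j]) (simp_all add: nbrs_empty)
    then show ?thesis using Suc.IH[OF inner(2,3)] by simp
  qed
qed auto

section \<open>Apex vertices of cells\<close>

text \<open>The \<open>t\<close>-corners of all level-\<open>j\<close> cells.\<close>

primrec apexes :: "nat \<Rightarrow> nat \<Rightarrow> (real \<times> real) set" where
  "apexes 0 t = {corner t}"
| "apexes (Suc j) t = (\<Union>i\<in>{1,2,3}. psi i ` apexes j t)"

lemma apexes_SG_verts: "t \<in> {1,2,3} \<Longrightarrow> apexes j t \<subseteq> SG_verts j"
proof (induction j)
  case 0
  then show ?case by auto
next
  case (Suc j)
  then show ?case unfolding apexes.simps SG_verts.simps by blast
qed

lemma apexes_bary_pos: "t \<in> {1,2,3} \<Longrightarrow> v \<in> apexes j t \<Longrightarrow> 0 < bary t v"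
proof (induction j arbitrary: v)
  case 0
  then show ?case using bary_corner[of t t] by simp
next
  case (Suc j)
  then obtain i x where i: "i \<in> {1,2,3}" "x \<in> apexes j t" "v = psi i x"
    unfolding apexes.simps by blast
  then show ?case using Suc.IH[of x] Suc.prems(1) bary_psi[OF i(1), of t x] by (auto split: if_splits)
qed

lemma corner_apexes_iff:
  assumes "i \<in> {1,2,3}" "t \<in> {1,2,3}"
  shows "corner i \<in> apexes j t \<longleftrightarrow> i = t"
proof
  assume "corner i \<in> apexes j t"
  then have "0 < bary t (corner i)" using apexes_bary_pos assms(2) by metis
  then show "i = t" using bary_corner[OF assms] by (simp split: if_splits)
next
  assume "i = t"
  have "corner t \<in> apexes j t"
  proof (induction j)
    case (Suc j)
    then have "psi t (corner t) \<in> apexes (Suc j) t"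
      unfolding apexes.simps using assms(2) by blast
    then show ?case by simp
  qed simp
  then show "corner i \<in> apexes j t" using \<open>i = t\<close> by simp
qed

text \<open>The corner \<open>k\<close> of the level-one cell \<open>t\<close> is also the corner
  \<open>t\<close> of cell \<open>k\<close>, so it is an apex even if it is none inside cell
  \<open>t\<close>: this is the second alternative.\<close>

lemma psi_mem_apexes_iff:
  assumes "i \<in> {1,2,3}" "t \<in> {1,2,3}" "x \<in> SG_verts j"
  shows "psi i x \<in> apexes (Suc j) t \<longleftrightarrow> x \<in> apexes j t \<or> (i = t \<and> x \<in> corner ` {1,2,3})"
proof
  assume "psi i x \<in> apexes (Suc j) t"
  then obtain k y where k: "k \<in> {1,2,3}" "y \<in> apexes j t" "psi i x = psi k y"
    unfolding apexes.simps by blast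
  show "x \<in> apexes j t \<or> (i = t \<and> x \<in> corner ` {1,2,3})"
  proof (cases "i = k")
    case True
    then show ?thesis using k injD[OF psi_inj, of i x y] by simp
  next
    case False
    have "x \<in> base_triangle" "y \<in> base_triangle"
      using assms(2,3) k(2) apexes_SG_verts SG_verts_triangle by blast+
    then have "x = corner k" "y = corner i"
      using psi_eq_psi_imp_corner[OF assms(1) k(1) False] k(3) by auto
    then show ?thesis using k(1,2) corner_apexes_iff[OF assms(1,2)] by auto
  qed
next
  assume "x \<in> apexes j t \<or> (i = t \<and> x \<in> corner ` {1,2,3})"
  then show "psi i x \<in> apexes (Suc j) t"
  proof
    assume "x \<in> apexes j t"
    then show ?thesis unfolding apexes.simps using assms(1) by blast
  next
    assume r: "i = t \<and> x \<in> corner ` {1,2,3}"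
    then obtain k where k: "k \<in> {1,2,3}" "x = corner k" by blast
    then have "psi i x = psi k (corner t)" using r psi_corner_swap by simp
    moreover have "corner t \<in> apexes j t" using corner_apexes_iff assms(2) by blast
    ultimately show ?thesis unfolding apexes.simps using k(1) by blast
  qed
qed

section \<open>Counting neighbours closer to a corner\<close>

definition ups :: "nat \<Rightarrow> nat \<Rightarrow> real \<times> real \<Rightarrow> nat" where
  "ups j t v = (\<Sum>w\<in>nbrs j v. if bary t v < bary t w then 1 else 0)"

lemma ups_Suc:
  assumes "t \<in> {1,2,3}"
  shows "ups (Suc j) t v = (\<Sum>i\<in>{1,2,3}. ups j t (psi_inv i v))"
  unfolding ups_def sum_nbrs_Suc
proof (intro sum.cong refl)
  fix i :: nat and w assume i: "i \<in> {1,2,3}"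
  show "(if bary t v < bary t (psi i w) then 1 else 0)
      = (if bary t (psi_inv i v) < bary t w then 1 else (0::nat))"
    unfolding bary_psi[OF i assms] bary_psi_inv[OF i assms] by auto
qed

lemma ups_empty: "v \<notin> SG_verts j \<Longrightarrow> ups j t v = 0"
  by (simp add: ups_def nbrs_empty)

lemma ups_corner:
  assumes "i \<in> {1,2,3}" "t \<in> {1,2,3}"
  shows "ups j t (corner i) = (if i = t then 0 else 1)"
proof (induction j)
  case 0
  obtain l r where lr: "distinct [i, l, r]" "{i, l, r} = {1, 2, 3}"
    using assms(1) by (rule other_two)
  then have m: "l \<in> {1,2,3}" "r \<in> {1,2,3}" by blast+
  have t: "t = i \<or> t = l \<or> t = r" using lr(2) assms(2) by blast
  have "corner l \<noteq> corner r" using corner_eq_iff[OF m] lr(1) by simp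
  then show ?case
    unfolding ups_def nbrs_0[OF lr] using t lr(1) bary_corner[OF assms] bary_corner[OF m(1) assms(2)]
      bary_corner[OF m(2) assms(2)] by auto
next
  case (Suc j)
  have "ups (Suc j) t (corner i) = ups j t (corner i)"
    unfolding ups_Suc[OF assms(2)] using assms by (intro local_sum_corner[where j = j]) (simp_all add: ups_empty)
  then show ?case using Suc by simp
qed

text \<open>The vertex lies in two level-\<open>j\<close> cells. In each it has exactly one higher
  neighbour, the apex of that cell, unless it is this apex itself, which happens in at most one of
  them.\<close>

lemma ups_noncorner:
  assumes "t \<in> {1,2,3}" "v \<in> SG_verts j" "v \<notin> corner ` {1,2,3}"
  shows "ups j t v = (if v \<in> apexes j t then 1 else 2)"
  using assms(2,3)
proof (induction j arbitrary: v)
  case (Suc j)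
  from Suc.prems(1) show ?case
  proof (cases rule: SG_verts_SucE)
    case (corner i)
    then show ?thesis using Suc.prems(2) by blast
  next
    case (mid i k)
    have "ups (Suc j) t v = ups j t (corner k) + ups j t (corner i)"
      unfolding ups_Suc[OF assms(1)] mid(4) using mid(1-3)
      by (intro local_sum_mid[where j = j]) (simp_all add: ups_empty)
    moreover have "v \<in> apexes (Suc j) t \<longleftrightarrow> k = t \<or> i = t"
      unfolding mid(4) psi_mem_apexes_iff[OF mid(1) assms(1) corner_SG_verts[OF mid(2)]]
        corner_apexes_iff[OF mid(2) assms(1)] using mid(2) by blast
    ultimately show ?thesis
      using mid(3) by (simp add: ups_corner[OF mid(1) assms(1)] ups_corner[OF mid(2) assms(1)])
  next
    case (inner i x)
    have "ups (Suc j) t v = ups j t x"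
      unfolding ups_Suc[OF assms(1)] inner(4) using inner(1-3)
      by (intro local_sum_inner[where j = j]) (simp_all add: ups_empty)
    moreover have "v \<in> apexes (Suc j) t \<longleftrightarrow> x \<in> apexes j t"
      unfolding inner(4) psi_mem_apexes_iff[OF inner(1) assms(1) inner(2)] using inner(3) by blast
    ultimately show ?thesis using Suc.IH[OF inner(2,3)] by simp
  qed
qed auto

section \<open>The potential of the identity\<close>

definition glap :: "nat \<Rightarrow> (real \<times> real \<Rightarrow> int) \<Rightarrow> real \<times> real \<Rightarrow> int" where
  "glap j f v = (\<Sum>w\<in>nbrs j v. f v - f w)"

lemma glap_Suc: "glap (Suc j) f v = (\<Sum>i\<in>{1,2,3}. glap j (\<lambda>x. f (psi i x)) (psi_inv i v))"
  by (simp only: glap_def sum_nbrs_Suc psi_psi_inv)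

lemma glap_cong:
  assumes "\<And>x. x \<in> SG_verts j \<Longrightarrow> f x = g x"
  shows "glap j f v = glap j g v"
  unfolding glap_def by (rule sum.cong) (auto dest!: nbrsD simp: assms)

lemma glap_empty: "v \<notin> SG_verts j \<Longrightarrow> glap j f v = 0"
  by (simp add: glap_def nbrs_empty)

text \<open>The midpoints are the only points with two representations \<open>psi i x\<close>, and
  by hypothesis both yield the same value, so any choice of a representation works.\<close>

lemma glue_cells:
  fixes F :: "nat \<Rightarrow> real \<times> real \<Rightarrow> 'b"
  assumes "\<And>i k. i \<in> {1,2,3} \<Longrightarrow> k \<in> {1,2,3} \<Longrightarrow> i \<noteq> k \<Longrightarrow> F i (corner k) = F k (corner i)"
  shows "\<exists>f. \<forall>i\<in>{1,2,3}. \<forall>x\<in>SG_verts j. f (psi i x) = F i x"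
proof -
  define P where "P v q \<longleftrightarrow> fst q \<in> {1,2,3} \<and> snd q \<in> SG_verts j \<and> psi (fst q) (snd q) = v" for v q
  define f where "f v = F (fst (SOME q. P v q)) (snd (SOME q. P v q))" for v
  have "f (psi i x) = F i x" if ix: "i \<in> {1,2,3}" "x \<in> SG_verts j" for i x
  proof -
    have "P (psi i x) (i, x)" using ix by (simp add: P_def)
    then have "P (psi i x) (SOME q. P (psi i x) q)" by (rule someI)
    moreover obtain k y where ky: "(SOME q. P (psi i x) q) = (k, y)" by (rule prod.exhaust)
    ultimately have k: "(SOME q. P (psi i x) q) = (k, y)" "k \<in> {1,2,3}" "y \<in> SG_verts j"
      "psi k y = psi i x" unfolding P_def by simp_all
    have fv: "f (psi i x) = F k y" by (simp add: f_def k(1))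
    show ?thesis
    proof (cases "i = k")
      case True
      then show ?thesis using fv k(4) injD[OF psi_inj, of i y x] by simp
    next
      case False
      have "x = corner k" "y = corner i"
        using psi_eq_psi_imp_corner[OF ix(1) k(2) False _ _ k(4)[symmetric]] ix(2) k(3) SG_verts_triangle
        by blast+
      then show ?thesis using assms[OF ix(1) k(2) False] fv by simp
    qed
  qed
  then show ?thesis by blast
qed

text \<open>In closed form \<open>(4 * 5 ^ j - 2 ^ j) / 3\<close>: the rise of the potential from
  the apex of a tile to its other corners when no flux leaves through the latter.\<close>

primrec tile_gap :: "nat \<Rightarrow> int" where
  "tile_gap 0 = 1"
| "tile_gap (Suc j) = 2 * tile_gap j + 4 * 5 ^ j"

text \<open>The parameters \<open>p\<close>, \<open>q\<close> are needed for the recursion. Up to a source term, the values at the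
  midpoints of a cell arise from those at its corners with the harmonic weights \<open>2/5, 2/5, 1/5\<close>;
  prescribing the corner differences as \<open>tile_gap j\<close> modulo \<open>5 ^ j\<close> keeps them integral down to
  level 0.\<close>

lemma tile_potential:
  assumes tlr: "distinct [t, l, r]" "{t, l, r} = {1, 2, 3}"
  shows "\<exists>f. f (corner t) = a \<and> f (corner l) = a + tile_gap j + 5 ^ j * p
      \<and> f (corner r) = a + tile_gap j + 5 ^ j * q
      \<and> glap j f (corner t) = 2 - 3 ^ j * (4 + p + q)
      \<and> glap j f (corner l) = 1 + 3 ^ j * (2 * p - q)
      \<and> glap j f (corner r) = 1 + 3 ^ j * (2 * q - p)
      \<and> (\<forall>v\<in>SG_verts j - corner ` {1,2,3}. glap j f v = (if v \<in> apexes j t then 3 else 2))"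
proof (induction j arbitrary: a p q)
  case 0
  have m: "t \<in> {1,2,3}" "l \<in> {1,2,3}" "r \<in> {1,2,3}" using tlr(2) by blast+
  have perm: "distinct [l, t, r]" "{l, t, r} = {1, 2, 3}" "distinct [r, t, l]" "{r, t, l} = {1, 2, 3}"
    using tlr by (auto simp: insert_commute)
  have ne: "corner t \<noteq> corner l" "corner t \<noteq> corner r" "corner l \<noteq> corner r"
    using corner_eq_iff[OF m(1,2)] corner_eq_iff[OF m(1,3)] corner_eq_iff[OF m(2,3)] tlr(1) by auto
  define f where "f x = (if x = corner t then a else if x = corner l then a + 1 + p else a + 1 + q)" for x
  have f: "f (corner t) = a" "f (corner l) = a + 1 + p" "f (corner r) = a + 1 + q"
    using ne by (auto simp: f_def)
  have "glap 0 f (corner t) = 2 - (4 + p + q)" "glap 0 f (corner l) = 1 + (2 * p - q)"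
    "glap 0 f (corner r) = 1 + (2 * q - p)"
    unfolding glap_def nbrs_0[OF tlr] nbrs_0[OF perm(1,2)] nbrs_0[OF perm(3,4)]
    using ne by (simp_all add: f) 
  then show ?case using f by (intro exI[of _ f]) auto
next
  case (Suc j)
  have m: "t \<in> {1,2,3}" "l \<in> {1,2,3}" "r \<in> {1,2,3}" using tlr(2) by blast+
  have d: "t \<noteq> l" "t \<noteq> r" "l \<noteq> r" "l \<noteq> t" "r \<noteq> t" "r \<noteq> l" using tlr(1) by auto
  \<comment> \<open>\<open>L\<close> and \<open>R\<close> are the values at the midpoints of the
    sides from \<open>t\<close> to \<open>l\<close> and \<open>r\<close>. The subcell parameters
    below are then forced: they are the corner differences minus \<open>tile_gap j\<close>, divided
    by \<open>5 ^ j\<close>. With them the multiples of \<open>3 ^ j\<close> cancel at all three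
    midpoints.\<close>
  define L where "L = a + tile_gap j + 5 ^ j * (4 + 2 * p + q)"
  define R where "R = a + tile_gap j + 5 ^ j * (4 + p + 2 * q)"
  obtain ft where ft: "ft (corner t) = a" "ft (corner l) = L" "ft (corner r) = R"
    "glap j ft (corner t) = 2 - 3 ^ j * (4 + (4 + 2 * p + q) + (4 + p + 2 * q))"
    "glap j ft (corner l) = 1 + 3 ^ j * (2 * (4 + 2 * p + q) - (4 + p + 2 * q))"
    "glap j ft (corner r) = 1 + 3 ^ j * (2 * (4 + p + 2 * q) - (4 + 2 * p + q))"
    "\<And>v. v \<in> SG_verts j \<Longrightarrow> v \<notin> corner ` {1,2,3} \<Longrightarrow> glap j ft v = (if v \<in> apexes j t then 3 else 2)"
    using Suc.IH[of a "4 + 2 * p + q" "4 + p + 2 * q"] unfolding L_def R_def by (metis DiffI)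
  obtain fl where fl: "fl (corner t) = L" "fl (corner l) = L + tile_gap j + 5 ^ j * (3 * p - q)"
    "fl (corner r) = L + tile_gap j + 5 ^ j * q"
    "glap j fl (corner t) = 2 - 3 ^ j * (4 + (3 * p - q) + q)"
    "glap j fl (corner l) = 1 + 3 ^ j * (2 * (3 * p - q) - q)"
    "glap j fl (corner r) = 1 + 3 ^ j * (2 * q - (3 * p - q))"
    "\<And>v. v \<in> SG_verts j \<Longrightarrow> v \<notin> corner ` {1,2,3} \<Longrightarrow> glap j fl v = (if v \<in> apexes j t then 3 else 2)"
    using Suc.IH[of L "3 * p - q" q] by (metis DiffI)
  obtain fr where fr: "fr (corner t) = R" "fr (corner l) = R + tile_gap j + 5 ^ j * p"
    "fr (corner r) = R + tile_gap j + 5 ^ j * (3 * q - p)"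
    "glap j fr (corner t) = 2 - 3 ^ j * (4 + p + (3 * q - p))"
    "glap j fr (corner l) = 1 + 3 ^ j * (2 * p - (3 * q - p))"
    "glap j fr (corner r) = 1 + 3 ^ j * (2 * (3 * q - p) - p)"
    "\<And>v. v \<in> SG_verts j \<Longrightarrow> v \<notin> corner ` {1,2,3} \<Longrightarrow> glap j fr v = (if v \<in> apexes j t then 3 else 2)"
    using Suc.IH[of R p "3 * q - p"] by (metis DiffI)
  define F where "F i = (if i = t then ft else if i = l then fl else fr)" for i
  have F: "F t = ft" "F l = fl" "F r = fr" using d by (auto simp: F_def)
  have tlr_cases: "i = t \<or> i = l \<or> i = r" if "i \<in> {1,2,3}" for i using that tlr(2) by blast
  have swap: "fl (corner r) = fr (corner l)"
    unfolding fl(3) fr(2) L_def R_def by (simp add: algebra_simps)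
  have compat: "F i (corner k) = F k (corner i)" if "i \<in> {1,2,3}" "k \<in> {1,2,3}" "i \<noteq> k" for i k
    using tlr_cases[OF that(1)] tlr_cases[OF that(2)] that(3) ft fl fr swap by (elim disjE) (simp_all add: F)
  have "\<exists>f. \<forall>i\<in>{1,2,3}. \<forall>x\<in>SG_verts j. f (psi i x) = F i x"
    by (rule glue_cells) (rule compat)
  then obtain f where "\<forall>i\<in>{1,2,3}. \<forall>x\<in>SG_verts j. f (psi i x) = F i x" ..
  then have f: "f (psi i x) = F i x" if "i \<in> {1,2,3}" "x \<in> SG_verts j" for i x
    using that by blast
  have gl: "glap (Suc j) f v = (\<Sum>i\<in>{1,2,3}. glap j (F i) (psi_inv i v))" for v
    unfolding glap_Suc by (intro sum.cong refl glap_cong) (use f in auto)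
  have fc: "f (corner i) = F i (corner i)" if "i \<in> {1,2,3}" for i
    using f[OF that corner_SG_verts[OF that]] by simp
  have gc: "glap (Suc j) f (corner i) = glap j (F i) (corner i)" if "i \<in> {1,2,3}" for i
    unfolding gl using that by (intro local_sum_corner[where j = j]) (simp_all add: glap_empty)
  have inner: "glap (Suc j) f v = (if v \<in> apexes (Suc j) t then 3 else 2)"
    if v: "v \<in> SG_verts (Suc j)" "v \<notin> corner ` {1,2,3}" for v
    using v(1)
  proof (cases rule: SG_verts_SucE)
    case (corner i)
    then show ?thesis using v(2) by blast
  next
    case (mid i k)
    have "glap (Suc j) f v = glap j (F i) (corner k) + glap j (F k) (corner i)"
      unfolding gl mid(4) using mid(1-3) by (intro local_sum_mid[where j = j]) (simp_all add: glap_empty)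
    moreover have "v \<in> apexes (Suc j) t \<longleftrightarrow> k = t \<or> i = t"
      unfolding mid(4) psi_mem_apexes_iff[OF mid(1) m(1) corner_SG_verts[OF mid(2)]]
        corner_apexes_iff[OF mid(2) m(1)] using mid(2) by blast
    \<comment> \<open>The remaining constants, 2 from a cell whose apex this is and 1 otherwise, add
      up to 3 at an apex and to 2 elsewhere.\<close>
    ultimately show ?thesis
      using tlr_cases[OF mid(1)] tlr_cases[OF mid(2)] mid(3) d
      by (elim disjE) (simp_all add: F ft fl fr algebra_simps)
  next
    case (inner i x)
    have "glap (Suc j) f v = glap j (F i) x"
      unfolding gl inner(4) using inner(1-3)
      by (intro local_sum_inner[where j = j]) (simp_all add: glap_empty)
    moreover have "v \<in> apexes (Suc j) t \<longleftrightarrow> x \<in> apexes j t"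
      unfolding inner(4) psi_mem_apexes_iff[OF inner(1) m(1) inner(2)] using inner(3) by blast
    ultimately show ?thesis
      using tlr_cases[OF inner(1)] ft(7)[OF inner(2,3)] fl(7)[OF inner(2,3)] fr(7)[OF inner(2,3)]
      by (auto simp: F)
  qed
  show ?case
  proof (intro exI[of _ f] conjI)
    show "f (corner t) = a" by (simp only: fc m F ft)
    show "f (corner l) = a + tile_gap (Suc j) + 5 ^ Suc j * p"
      by (simp only: fc m F fl) (simp add: L_def algebra_simps)
    show "f (corner r) = a + tile_gap (Suc j) + 5 ^ Suc j * q"
      by (simp only: fc m F fr) (simp add: R_def algebra_simps)
    show "glap (Suc j) f (corner t) = 2 - 3 ^ Suc j * (4 + p + q)"
      by (simp only: gc m F ft) (simp add: algebra_simps)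
    show "glap (Suc j) f (corner l) = 1 + 3 ^ Suc j * (2 * p - q)"
      by (simp only: gc m F fl) (simp add: algebra_simps)
    show "glap (Suc j) f (corner r) = 1 + 3 ^ Suc j * (2 * q - p)"
      by (simp only: gc m F fr) (simp add: algebra_simps)
    show "\<forall>v\<in>SG_verts (Suc j) - corner ` {1,2,3}.
        glap (Suc j) f v = (if v \<in> apexes (Suc j) t then 3 else 2)"
      using inner by blast
  qed
qed

text \<open>\<open>id_conf j\<close> lives on level \<open>Suc j\<close>; level 0 is irrelevant for the limit.\<close>

definition id_conf :: "nat \<Rightarrow> real \<times> real \<Rightarrow> nat" where
  "id_conf j v = (if v \<in> SG_verts (Suc j)
     then if v \<in> (\<Union>t\<in>{1,2,3}. psi t ` apexes j t) - corner ` {1,2,3} then 3 else 2 else 0)"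

lemma id_conf_corner: "i \<in> {1,2,3} \<Longrightarrow> id_conf j (corner i) = 2"
  using corner_SG_verts[of i "Suc j"] by (auto simp: id_conf_def)

text \<open>In both adjacent level-one cells the midpoint is a base corner, and the only corner in
  \<open>apexes j t\<close> is \<open>corner t\<close>.\<close>

lemma id_conf_mid:
  assumes "i \<in> {1,2,3}" "k \<in> {1,2,3}" "i \<noteq> k"
  shows "id_conf j (psi i (corner k)) = 2"
proof -
  have "psi i (corner k) \<notin> psi t ` apexes j t" if t: "t \<in> {1,2,3}" for t
  proof
    assume "psi i (corner k) \<in> psi t ` apexes j t"
    then obtain y where y: "y \<in> apexes j t" "psi i (corner k) = psi t y" by blast
    show False
    proof (cases "i = t")
      case True
      then have "corner k = y" using y(2) injD[OF psi_inj] by blast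
      then show False using y(1) corner_apexes_iff[OF assms(2) t] True assms(3) by simp
    next
      case False
      have "y \<in> base_triangle" using y(1) t apexes_SG_verts SG_verts_triangle by blast
      then have "y = corner i"
        using psi_eq_psi_imp_corner(2)[OF assms(1) t False corner_triangle[OF assms(2)] _ y(2)] by simp
      then show False using y(1) corner_apexes_iff[OF assms(1) t] False by simp
    qed
  qed
  then have "psi i (corner k) \<notin> (\<Union>t\<in>{1,2,3}. psi t ` apexes j t)" by blast
  moreover have "psi i (corner k) \<in> SG_verts (Suc j)" using psi_SG_verts corner_SG_verts assms by metis
  ultimately show ?thesis by (simp only: id_conf_def if_True Diff_iff simp_thms if_False)
qed

lemma id_conf_inner:
  assumes "i \<in> {1,2,3}" "x \<in> SG_verts j" "x \<notin> corner ` {1,2,3}"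
  shows "id_conf j (psi i x) = (if x \<in> apexes j i then 3 else 2)"
proof -
  have "psi i x \<in> (\<Union>t\<in>{1,2,3}. psi t ` apexes j t) \<longleftrightarrow> x \<in> apexes j i"
  proof
    assume "psi i x \<in> (\<Union>t\<in>{1,2,3}. psi t ` apexes j t)"
    then obtain t y where t: "t \<in> {1,2,3}" "y \<in> apexes j t" "psi i x = psi t y" by blast
    show "x \<in> apexes j i"
    proof (cases "i = t")
      case True
      then show ?thesis using t(2,3) injD[OF psi_inj, of i x y] by simp
    next
      case False
      have "x \<in> base_triangle" "y \<in> base_triangle"
        using assms(2) t(1,2) apexes_SG_verts SG_verts_triangle by blast+
      then have "x = corner t"
        using psi_eq_psi_imp_corner(1)[OF assms(1) t(1) False] t(3) by simp
      then show ?thesis using assms(3) t(1) by blast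
    qed
  qed (use assms(1) in blast)
  moreover have "psi i x \<in> SG_verts (Suc j)" using psi_SG_verts assms by metis
  ultimately show ?thesis using psi_inner_notin[OF assms]
    by (simp only: id_conf_def if_True Diff_iff simp_thms)
qed

lemma id_potential:
  obtains f where "\<And>v. v \<in> SG_verts (Suc j) \<Longrightarrow>
    glap (Suc j) f v + (if v \<in> corner ` {1,2,3} then 2 * f v else 0) = int (id_conf j v)"
proof -
  \<comment> \<open>\<open>p = q = 0\<close> leaves exactly 1 at each base corner of a tile, so two
    tiles glue to 2 at a junction. The flux \<open>4 * 3 ^ j\<close> goes to the gasket corner,
    where the two sink edges balance it if the potential is \<open>2 * 3 ^ j\<close>.\<close>
  define P where "P t f \<longleftrightarrow> f (corner t) = 2 * 3 ^ j \<and> glap j f (corner t) = 2 - 3 ^ j * 4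
      \<and> (\<forall>k\<in>{1,2,3}. k \<noteq> t \<longrightarrow> f (corner k) = 2 * 3 ^ j + tile_gap j \<and> glap j f (corner k) = 1)
      \<and> (\<forall>v\<in>SG_verts j - corner ` {1,2,3}. glap j f v = (if v \<in> apexes j t then 3 else 2))" for t f
  have "\<exists>f. P t f" if t: "t \<in> {1,2,3}" for t
  proof -
    obtain l r where lr: "distinct [t, l, r]" "{t, l, r} = {1, 2, 3}" using t by (rule other_two)
    have "k = t \<or> k = l \<or> k = r" if "k \<in> {1,2,3}" for k using that lr(2) by blast
    then show ?thesis
      unfolding P_def using tile_potential[OF lr, of "2 * 3 ^ j" j 0 0] by (elim exE, intro exI) auto
  qed
  then have "\<forall>t\<in>{1,2,3}. \<exists>f. P t f" by (rule ballI)
  from bchoice[OF this] obtain F where PF: "\<forall>t\<in>{1,2,3}. P t (F t)" by (rule exE)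
  have F: "F t (corner t) = 2 * 3 ^ j" "glap j (F t) (corner t) = 2 - 3 ^ j * 4"
      "\<And>k. k \<in> {1,2,3} \<Longrightarrow> k \<noteq> t \<Longrightarrow> F t (corner k) = 2 * 3 ^ j + tile_gap j"
      "\<And>k. k \<in> {1,2,3} \<Longrightarrow> k \<noteq> t \<Longrightarrow> glap j (F t) (corner k) = 1"
      "\<And>v. v \<in> SG_verts j \<Longrightarrow> v \<notin> corner ` {1,2,3} \<Longrightarrow> glap j (F t) v = (if v \<in> apexes j t then 3 else 2)"
    if "t \<in> {1,2,3}" for t
    using bspec[OF PF that] unfolding P_def by blast+
  have compat: "F i (corner k) = F k (corner i)" if "i \<in> {1,2,3}" "k \<in> {1,2,3}" "i \<noteq> k" for i k
    using F(3)[OF that(1,2)] F(3)[OF that(2,1)] that(3) by simp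
  have "\<exists>f. \<forall>i\<in>{1,2,3}. \<forall>x\<in>SG_verts j. f (psi i x) = F i x"
    by (rule glue_cells) (rule compat)
  then obtain f where "\<forall>i\<in>{1,2,3}. \<forall>x\<in>SG_verts j. f (psi i x) = F i x" ..
  then have f: "f (psi i x) = F i x" if "i \<in> {1,2,3}" "x \<in> SG_verts j" for i x
    using that by blast
  have gl: "glap (Suc j) f v = (\<Sum>i\<in>{1,2,3}. glap j (F i) (psi_inv i v))" for v
    unfolding glap_Suc by (intro sum.cong refl glap_cong) (use f in auto)
  have "glap (Suc j) f v + (if v \<in> corner ` {1,2,3} then 2 * f v else 0) = int (id_conf j v)"
    if v: "v \<in> SG_verts (Suc j)" for v
    using v
  proof (cases rule: SG_verts_SucE)
    case (corner i)
    have "glap (Suc j) f v = glap j (F i) (corner i)"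
      unfolding gl corner(2) using corner(1)
      by (intro local_sum_corner[where j = j]) (simp_all add: glap_empty)
    moreover have "f v = 2 * 3 ^ j"
      using f[OF corner(1) corner_SG_verts[OF corner(1)]] F(1)[OF corner(1)] corner(2) by simp
    moreover have "v \<in> corner ` {1,2,3}" using corner by blast
    ultimately show ?thesis using F(2)[OF corner(1)] id_conf_corner[OF corner(1)] corner(2) by simp
  next
    case (mid i k)
    have "glap (Suc j) f v = glap j (F i) (corner k) + glap j (F k) (corner i)"
      unfolding gl mid(4) using mid(1-3) by (intro local_sum_mid[where j = j]) (simp_all add: glap_empty)
    then show ?thesis
      using F(4)[OF mid(1,2)] F(4)[OF mid(2,1)] mid(3) psi_corner_notin[OF mid(1-3)] id_conf_mid[OF mid(1-3)]
      by (simp only: mid(4) if_False) simp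
  next
    case (inner i x)
    have "glap (Suc j) f v = glap j (F i) x"
      unfolding gl inner(4) using inner(1-3)
      by (intro local_sum_inner[where j = j]) (simp_all add: glap_empty)
    then show ?thesis
      using F(5)[OF inner(1-3)] psi_inner_notin[OF inner(1-3)] id_conf_inner[OF inner(1-3)]
      by (simp only: inner(4) if_False) simp
  qed
  then show ?thesis using that by blast
qed

section \<open>The identity of the sandpile group\<close>

lemma nonsink_SG_normal: "nonsink (SG_normal n) = Some ` SG_verts n"
  by (simp add: SG_normal_def)

lemma sum_nonsink_SG_normal:
  "(\<Sum>w\<in>nonsink (SG_normal n). g w) = (\<Sum>w\<in>SG_verts n. g (Some w))"
  unfolding nonsink_SG_normal by (subst sum.reindex) simp_all

lemma edge_mult_Some: "edge_mult (SG_normal n) (Some v) (Some w) = (if w \<in> nbrs n v then 1 else 0)"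
  by (simp add: SG_normal_def nbrs_def)

lemma edge_mult_sink:
  "edge_mult (SG_normal n) (Some v) (sink (SG_normal n)) = (if v \<in> corner ` {1,2,3} then 2 else 0)"
  by (simp add: SG_normal_def)

lemma sum_edge_mult:
  fixes g :: "real \<times> real \<Rightarrow> 'b::comm_semiring_1"
  shows "(\<Sum>w\<in>SG_verts n. of_nat (edge_mult (SG_normal n) (Some v) (Some w)) * g w) = sum g (nbrs n v)"
proof -
  have "nbrs n v \<subseteq> SG_verts n" using nbrsD by blast
  then show ?thesis
    unfolding edge_mult_Some using finite_SG_verts[of n]
    by (simp add: if_distrib[of of_nat] if_distrib[of "\<lambda>t. t * _"] sum.If_cases Int_absorb1 cong: if_cong)
qed

interpretation SG_normal: sink_multigraph "SG_normal n" for n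
proof
  show "finite (nonsink (SG_normal n))" by (simp add: nonsink_SG_normal finite_SG_verts)
  show "sink (SG_normal n) \<notin> nonsink (SG_normal n)" by (auto simp: SG_normal_def)
  show "edge_mult (SG_normal n) v w = edge_mult (SG_normal n) w v" for v w
    by (cases v; cases w) (auto simp: SG_normal_def insert_commute)
  show "edge_mult (SG_normal n) v v = 0" for v
  proof (cases v)
    case (Some x)
    then show ?thesis using nbrsD[of x n x] by (auto simp: edge_mult_Some)
  qed (simp add: SG_normal_def)
qed

lemma degree_SG_normal:
  assumes "v \<in> SG_verts n"
  shows "degree_of (SG_normal n) (Some v) = 4"
proof -
  have "degree_of (SG_normal n) (Some v) = card (nbrs n v) + (if v \<in> corner ` {1,2,3} then 2 else 0)"
    unfolding SG_normal.degree_eq sum_nonsink_SG_normal edge_mult_sink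
    using sum_edge_mult[of n v "\<lambda>_. 1::nat"] by simp
  then show ?thesis using card_nbrs_corner[of _ n] card_nbrs_noncorner[OF assms] by auto
qed

lemma lap_apply_SG_normal:
  assumes "v \<in> SG_verts n"
  shows "lap_apply (SG_normal n) (case_option 0 f) (Some v)
    = glap n f v + (if v \<in> corner ` {1,2,3} then 2 * f v else 0)"
proof -
  have v: "Some v \<in> nonsink (SG_normal n)" using assms by (simp add: nonsink_SG_normal)
  show ?thesis
    unfolding SG_normal.lap_apply_eq[OF v] sum_nonsink_SG_normal edge_mult_sink glap_def
    using sum_edge_mult[of n v "\<lambda>w. f v - f w"] by simp
qed

text \<open>In the \<open>i\<close>-th level-one cell the height is the \<open>i\<close>-th barycentric coordinate; the burning
  process runs from the corners downwards along it.\<close>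

definition height :: "real \<times> real \<Rightarrow> real" where
  "height v = max (bary 1 v) (max (bary 2 v) (bary 3 v))"

text \<open>On the level-one cell \<open>i\<close> the \<open>i\<close>-th coordinate is at least
  1/2 and hence the largest.\<close>

lemma height_psi:
  assumes "i \<in> {1,2,3}" "x \<in> base_triangle"
  shows "height (psi i x) = (bary i x + 1) / 2"
proof -
  have "0 \<le> bary 1 x" "0 \<le> bary 2 x" "0 \<le> bary 3 x" using triangleD[OF assms(2)] by simp_all
  then show ?thesis
    using bary_psi[OF assms(1), of 1 x] bary_psi[OF assms(1), of 2 x] bary_psi[OF assms(1), of 3 x]
      bary_sum[of x] assms(1) unfolding height_def by auto
qed

text \<open>Every edge stays inside one level-one cell, where comparing heights is comparing a
  single coordinate.\<close>

lemma card_higher_nbrs: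
  "card {w \<in> nbrs (Suc j) v. height v < height w} = (\<Sum>i\<in>{1,2,3}. ups j i (psi_inv i v))"
proof -
  have "card {w \<in> nbrs (Suc j) v. height v < height w}
      = (\<Sum>w\<in>nbrs (Suc j) v. if height v < height w then 1 else 0)"
    using finite_nbrs[of "Suc j" v] by (simp add: sum.If_cases Int_def)
  also have "\<dots> = (\<Sum>i\<in>{1,2,3}. ups j i (psi_inv i v))"
    unfolding sum_nbrs_Suc ups_def
  proof (intro sum.cong refl)
    fix i :: nat and w assume i: "i \<in> {1,2,3}" and w: "w \<in> nbrs j (psi_inv i v)"
    have "w \<in> base_triangle" "psi_inv i v \<in> base_triangle"
      using nbrsD[OF w] SG_verts_triangle by blast+
    then have "height (psi i w) = (bary i w + 1) / 2" "height v = (bary i (psi_inv i v) + 1) / 2"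
      using height_psi[OF i] psi_psi_inv[of i v] by metis+
    then show "(if height v < height (psi i w) then 1 else 0)
        = (if bary i (psi_inv i v) < bary i w then 1 else (0::nat))" by simp
  qed
  finally show ?thesis .
qed

text \<open>Of the 4 neighbours of a non-corner, 2 are higher, or only 1 where the value is 3; a
  gasket corner has just 2 neighbours. So a vertex burns once everything higher has burnt.\<close>

lemma id_conf_burnable:
  assumes "v \<in> SG_verts (Suc j)"
  shows "card {w \<in> nbrs (Suc j) v. \<not> height v < height w} \<le> id_conf j v"
proof -
  let ?N = "nbrs (Suc j) v"
  have "?N = {w \<in> ?N. \<not> height v < height w} \<union> {w \<in> ?N. height v < height w}" by blast
  then have "card ?N = card ({w \<in> ?N. \<not> height v < height w} \<union> {w \<in> ?N. height v < height w})" by simp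
  also have "\<dots> = card {w \<in> ?N. \<not> height v < height w} + card {w \<in> ?N. height v < height w}"
    by (rule card_Un_disjoint) (auto simp: finite_nbrs)
  finally have card: "card ?N = card {w \<in> ?N. \<not> height v < height w} + (\<Sum>i\<in>{1,2,3}. ups j i (psi_inv i v))"
    unfolding card_higher_nbrs .
  from assms show ?thesis
  proof (cases rule: SG_verts_SucE)
    case (corner i)
    then show ?thesis using card card_nbrs_corner[OF corner(1)] id_conf_corner[OF corner(1)] by simp
  next
    case (mid i k)
    have "(\<Sum>i\<in>{1,2,3}. ups j i (psi_inv i v)) = ups j i (corner k) + ups j k (corner i)"
      unfolding mid(4) using mid(1-3) by (intro local_sum_mid[where j = j]) (simp_all add: ups_empty)
    also have "\<dots> = 2" using ups_corner[OF mid(1,2)] ups_corner[OF mid(2,1)] mid(3) by simp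
    finally show ?thesis
      using card card_nbrs_noncorner[OF assms] psi_corner_notin[OF mid(1-3)] id_conf_mid[OF mid(1-3), of j]
      unfolding mid(4) by linarith
  next
    case (inner i x)
    have "(\<Sum>i\<in>{1,2,3}. ups j i (psi_inv i v)) = ups j i x"
      unfolding inner(4) using inner(1-3) by (intro local_sum_inner[where j = j]) (simp_all add: ups_empty)
    also have "\<dots> = (if x \<in> apexes j i then 1 else 2)" by (rule ups_noncorner[OF inner(1-3)])
    finally show ?thesis
      using card card_nbrs_noncorner[OF assms] psi_inner_notin[OF inner(1-3)] id_conf_inner[OF inner(1-3)]
      unfolding inner(4) by (simp split: if_splits)
  qed
qed

lemma id_conf_bounds: "v \<in> SG_verts (Suc j) \<Longrightarrow> 2 \<le> id_conf j v" "id_conf j v \<le> 3"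
  by (auto simp: id_conf_def)

text \<open>Minimum principle: at a negative minimum neither the Laplacian nor the sink term can be
  positive.\<close>

lemma potential_nonneg:
  assumes "\<And>v. v \<in> SG_verts n \<Longrightarrow> 0 < glap n f v + (if v \<in> corner ` {1,2,3} then 2 * f v else 0)"
    "x \<in> SG_verts n"
  shows "0 \<le> f x"
proof (rule ccontr)
  assume neg: "\<not> 0 \<le> f x"
  obtain v where v: "v \<in> SG_verts n" "\<And>w. w \<in> SG_verts n \<Longrightarrow> f v \<le> f w"
    using ex_is_arg_min_if_finite[OF finite_SG_verts[of n], of f] assms(2)
    by (auto simp: is_arg_min_linorder)
  have "f v < 0" using v(2)[OF assms(2)] neg by simp
  moreover have "glap n f v \<le> 0"
    unfolding glap_def
  proof (rule sum_nonpos)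
    fix w assume "w \<in> nbrs n v"
    then have "w \<in> SG_verts n" using nbrsD by blast
    then show "f v - f w \<le> 0" using v(2) by simp
  qed
  ultimately show False using assms(1)[OF v(1)] by (simp split: if_splits)
qed

lemma SG_id_eq: "SG_id (Suc j) = id_conf j"
proof -
  obtain f where f: "\<And>v. v \<in> SG_verts (Suc j) \<Longrightarrow>
    glap (Suc j) f v + (if v \<in> corner ` {1,2,3} then 2 * f v else 0) = int (id_conf j v)"
    by (rule id_potential) (rule that)
  have f0: "0 \<le> f v" if "v \<in> SG_verts (Suc j)" for v
    using that proof (rule potential_nonneg[rotated])
    fix v assume v: "v \<in> SG_verts (Suc j)"
    show "0 < glap (Suc j) f v + (if v \<in> corner ` {1,2,3} then 2 * f v else 0)"
      unfolding f[OF v] using id_conf_bounds(1)[OF v] by simp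
  qed
  interpret sandpile_identity "SG_normal (Suc j)" "case_option 0 (id_conf j)" "case_option 0 f"
  proof
    show "case_option 0 (id_conf j) \<in> sandpiles (SG_normal (Suc j))"
      unfolding sandpiles_def nonsink_SG_normal
      by (auto simp: id_conf_def image_iff split: option.split)
    show "stable (SG_normal (Suc j)) (case_option 0 (id_conf j))"
      unfolding stable_def nonsink_SG_normal
    proof (intro ballI, elim imageE)
      fix v x assume "v = Some x" "x \<in> SG_verts (Suc j)"
      then show "case_option 0 (id_conf j) v < degree_of (SG_normal (Suc j)) v"
        using id_conf_bounds(2)[of j x] degree_SG_normal[of x "Suc j"] by simp
    qed
    show "1 \<le> case_option 0 (id_conf j) v" if v: "v \<in> nonsink (SG_normal (Suc j))" for v
    proof -
      from v obtain x where "v = Some x" "x \<in> SG_verts (Suc j)" unfolding nonsink_SG_normal by blast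
      then show ?thesis using id_conf_bounds(1)[of x j] by simp
    qed
    show "0 \<le> case_option 0 f v" if v: "v \<in> nonsink (SG_normal (Suc j))" for v
    proof -
      from v obtain x where "v = Some x" "x \<in> SG_verts (Suc j)" unfolding nonsink_SG_normal by blast
      then show ?thesis using f0[of x] by simp
    qed
    show "lap_apply (SG_normal (Suc j)) (case_option 0 f) v = int (case_option 0 (id_conf j) v)"
      if v: "v \<in> nonsink (SG_normal (Suc j))" for v
    proof -
      from v obtain x where x: "v = Some x" "x \<in> SG_verts (Suc j)" unfolding nonsink_SG_normal by blast
      show ?thesis unfolding x(1) lap_apply_SG_normal[OF x(2)] f[OF x(2)] by simp
    qed
    show "\<exists>v\<in>S. (\<Sum>w\<in>S. edge_mult (SG_normal (Suc j)) v w) \<le> case_option 0 (id_conf j) v"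
      if S: "S \<subseteq> nonsink (SG_normal (Suc j))" "S \<noteq> {}" for S
    proof -
      obtain S' where S': "S' \<subseteq> SG_verts (Suc j)" "S = Some ` S'"
        using S(1) unfolding nonsink_SG_normal by (meson subset_imageE)
      have fin: "finite S'" using S'(1) finite_SG_verts finite_subset by blast
      have "S' \<noteq> {}" using S(2) S'(2) by simp
      \<comment> \<open>The highest vertex of the set burns first: its neighbours inside the set are
        not higher.\<close>
      then obtain v where v: "v \<in> S'" "\<And>w. w \<in> S' \<Longrightarrow> height w \<le> height v"
        using ex_is_arg_min_if_finite[OF fin, of "\<lambda>w. - height w"] by (auto simp: is_arg_min_linorder)
      have vV: "v \<in> SG_verts (Suc j)" using v(1) S'(1) by blast
      have "(\<Sum>w\<in>S. edge_mult (SG_normal (Suc j)) (Some v) w) = (\<Sum>w\<in>S'. if w \<in> nbrs (Suc j) v then 1 else 0)"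
        unfolding S'(2) by (subst sum.reindex) (simp_all add: edge_mult_Some)
      also have "\<dots> = card (S' \<inter> nbrs (Suc j) v)"
        using fin by (simp add: sum.If_cases Int_def)
      also have "\<dots> \<le> card {w \<in> nbrs (Suc j) v. \<not> height v < height w}"
        by (rule card_mono) (use finite_nbrs v(2) in \<open>auto simp: not_less\<close>)
      also have "\<dots> \<le> id_conf j v" by (rule id_conf_burnable[OF vV])
      finally show ?thesis using v(1) S'(2) by (intro bexI[of _ "Some v"]) auto
    qed
  qed
  show ?thesis unfolding SG_id_def one_sandpile_group by simp
qed

section \<open>The attractor\<close>

lemma dist_psi: "dist (psi i x) (psi i y) = dist x y / 2"
proof -
  have "psi i x - psi i y = (1/2) *\<^sub>R (x - y)" by (simp add: psi_def scaleR_diff_right)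
  then show ?thesis by (simp add: dist_norm)
qed

lemma continuous_on_psi: "continuous_on A (psi i)"
  unfolding psi_def by (intro continuous_intros)

lemma closed_base_triangle: "closed base_triangle"
proof -
  have "base_triangle = (\<Inter>k\<in>{1,2,3}. {x. 0 \<le> bary k x})" by (auto simp: base_triangle_def)
  moreover have "closed {x. 0 \<le> bary k x}" for k
    unfolding bary_def by (cases "k = 1"; cases "k = 2"; simp; intro closed_Collect_le continuous_intros; simp)
  ultimately show ?thesis using closed_INT[of "{1,2,3}" "\<lambda>k. {x. 0 \<le> bary k x}"] by metis
qed

text \<open>The corners span an equilateral triangle of side 1. This translates the balls of
  \<open>near_verts\<close> into coordinates.\<close>

lemma dist_bary:
  "(dist x y)\<^sup>2 = ((bary 1 x - bary 1 y)\<^sup>2 + (bary 2 x - bary 2 y)\<^sup>2 + (bary 3 x - bary 3 y)\<^sup>2) / 2"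
proof -
  obtain a b where x: "x = (a, b)" by (rule prod.exhaust)
  obtain c d where y: "y = (c, d)" by (rule prod.exhaust)
  define s where "s = (b - d) / sqrt 3"
  have s: "b / sqrt 3 - d / sqrt 3 = s" "(b - d)\<^sup>2 = 3 * s\<^sup>2"
    by (simp add: s_def diff_divide_distrib) (simp add: s_def power_divide)
  have e: "bary 1 x - bary 1 y = - (a - c) - s" "bary 2 x - bary 2 y = (a - c) - s"
    "bary 3 x - bary 3 y = 2 * s"
    using s(1) by (simp_all add: bary_def x y)
  have "(dist x y)\<^sup>2 = (a - c)\<^sup>2 + (b - d)\<^sup>2"
    by (simp add: x y dist_Pair_Pair dist_real_def)
  also have "\<dots> = ((- (a - c) - s)\<^sup>2 + ((a - c) - s)\<^sup>2 + (2 * s)\<^sup>2) / 2"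
    unfolding s(2) by (simp add: power2_eq_square algebra_simps)
  finally show ?thesis unfolding e .
qed

lemma dist_corner_le:
  assumes "x \<in> base_triangle" "i \<in> {1,2,3}"
  shows "dist x (corner i) \<le> 1"
proof -
  have nn: "0 \<le> bary 1 x" "0 \<le> bary 2 x" "0 \<le> bary 3 x"
    using triangleD[OF assms(1)] by simp_all
  have aux: "(a - 1)\<^sup>2 + b\<^sup>2 + c\<^sup>2 \<le> 2" if "0 \<le> a" "0 \<le> b" "0 \<le> c" "a + b + c = 1" for a b c :: real
  proof -
    have "(1 - a)\<^sup>2 \<le> 1" "(b + c)\<^sup>2 \<le> 1" using that by (auto intro!: power_le_one)
    moreover have "b\<^sup>2 + c\<^sup>2 \<le> (b + c)\<^sup>2" using that by (simp add: power2_sum)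
    moreover have "(a - 1)\<^sup>2 = (1 - a)\<^sup>2" by (rule power2_commute)
    ultimately show ?thesis by linarith
  qed
  have "(dist x (corner i))\<^sup>2 \<le> 1\<^sup>2"
    unfolding dist_bary using assms(2) bary_corner[OF assms(2), of 1] bary_corner[OF assms(2), of 2]
      bary_corner[OF assms(2), of 3] nn bary_sum[of x] aux[of "bary 1 x" "bary 2 x" "bary 3 x"]
      aux[of "bary 2 x" "bary 1 x" "bary 3 x"] aux[of "bary 3 x" "bary 1 x" "bary 2 x"]
    by auto
  then show ?thesis by (rule power2_le_imp_le) simp
qed

lemma compact_base_triangle: "compact base_triangle"
proof -
  have "base_triangle \<subseteq> cball (corner 1) 1"
    using dist_corner_le[of _ 1] by (auto simp: dist_commute)
  then show ?thesis
    using closed_base_triangle bounded_subset[OF bounded_cball] compact_eq_bounded_closed by blast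
qed

text \<open>A point of \<open>K\<close> farthest from \<open>L\<close> is the image of a point of
  \<open>K\<close>, and each map halves the distance to \<open>L\<close>; so the largest distance is
  0.\<close>

lemma invariant_subset:
  assumes K: "compact K" "K = (\<Union>i\<in>{1,2,3}. psi i ` K)"
    and L: "L \<noteq> {}" "compact L" "L = (\<Union>i\<in>{1,2,3}. psi i ` L)"
  shows "K \<subseteq> L"
proof (cases "K = {}")
  case False
  have "continuous_on K (\<lambda>x. infdist x L)" by (intro continuous_intros)
  then obtain x where x: "x \<in> K" "\<And>y. y \<in> K \<Longrightarrow> infdist y L \<le> infdist x L"
    using continuous_attains_sup[OF K(1) False] by blast
  from x(1) K(2) obtain i y where y: "i \<in> {1,2,3}" "y \<in> K" "x = psi i y" by blast
  obtain z where z: "z \<in> L" "infdist y L = dist y z"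
    using infdist_attains_inf[OF compact_imp_closed[OF L(2)] L(1)] by blast
  have "psi i z \<in> L" using L(3) y(1) z(1) by blast
  then have "infdist x L \<le> dist x (psi i z)" by (rule infdist_le)
  also have "\<dots> = infdist y L / 2" using z(2) y(3) by (simp add: dist_psi)
  also have "\<dots> \<le> infdist x L / 2" using x(2)[OF y(2)] by simp
  finally have "infdist x L \<le> 0" by simp
  then have "infdist y L = 0" if "y \<in> K" for y
    using x(2)[OF that] infdist_nonneg[of y L] by linarith
  then show ?thesis using in_closed_iff_infdist_zero[OF compact_imp_closed[OF L(2)] L(1)] by blast
qed simp

lemma SG_verts_mono: "SG_verts n \<subseteq> SG_verts (Suc n)"
proof (induction n)
  case 0
  have "corner i \<in> SG_verts (Suc 0)" if "i \<in> {1,2,3}" for i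
    using that by (rule corner_SG_verts)
  then show ?case unfolding SG_verts.simps(1) by blast
next
  case (Suc n)
  show ?case
    unfolding SG_verts.simps(2)[of "Suc n"] unfolding SG_verts.simps(2)[of n] using Suc
    by (intro UN_mono subset_refl image_mono)
       (simp only: SG_verts.simps(2))
qed

text \<open>The closure of all vertices is compact and invariant, and
  \<open>invariant_subset\<close> in both directions makes it the only such set, so it is what
  \<open>THE\<close> selects.\<close>

lemma SG_eq_closure: "SG = closure (\<Union>n. SG_verts n)"
  and SG_invariant: "SG = (\<Union>i\<in>{1,2,3}. psi i ` SG)"
proof -
  define V where "V = (\<Union>n. SG_verts n)"
  define K where "K = closure V"
  have VT: "V \<subseteq> base_triangle" unfolding V_def using SG_verts_triangle by blast
  then have KT: "K \<subseteq> base_triangle" unfolding K_def using closed_base_triangle by (rule closure_minimal)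
  have comp: "compact K"
    using KT compact_base_triangle unfolding K_def
    by (metis closed_closure compact_Int_closed inf.absorb_iff2)
  have ne: "K \<noteq> {}"
  proof -
    have "corner 1 \<in> V" unfolding V_def using corner_SG_verts[of 1 0] by blast
    then show ?thesis using closure_subset[of V] unfolding K_def by blast
  qed
  have "psi i ` V \<subseteq> V" if "i \<in> {1,2,3}" for i
    unfolding V_def using psi_SG_verts[OF that] by blast
  then have sub: "psi i ` K \<subseteq> K" if "i \<in> {1,2,3}" for i
    unfolding K_def using that closure_subset[of V]
    by (intro image_closure_subset continuous_on_psi closed_closure) blast
  have "SG_verts n \<subseteq> (\<Union>i\<in>{1,2,3}. psi i ` V)" for n
    by (rule order_trans[OF SG_verts_mono])
       (unfold SG_verts.simps V_def, intro UN_mono subset_refl image_mono UN_upper UNIV_I)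
  then have "V \<subseteq> (\<Union>i\<in>{1,2,3}. psi i ` V)" unfolding V_def by (rule UN_least)
  also have "\<dots> \<subseteq> (\<Union>i\<in>{1,2,3}. psi i ` K)"
    unfolding K_def by (intro UN_mono subset_refl image_mono closure_subset)
  finally have "K \<subseteq> (\<Union>i\<in>{1,2,3}. psi i ` K)"
    unfolding K_def
    by (intro closure_minimal compact_imp_closed compact_UN)
       (auto intro!: compact_continuous_image continuous_on_psi comp[unfolded K_def])
  then have inv: "K = (\<Union>i\<in>{1,2,3}. psi i ` K)" using sub by (intro equalityI UN_least)
  have "SG = K"
    unfolding SG_def
  proof (rule the_equality)
    show "K \<noteq> {} \<and> compact K \<and> K = (\<Union>i\<in>{1,2,3}. psi i ` K)" using ne comp inv by (intro conjI)
    fix L assume "L \<noteq> {} \<and> compact L \<and> L = (\<Union>i\<in>{1,2,3}. psi i ` L)"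
    then show "L = K" using invariant_subset[of L K] invariant_subset[of K L] ne comp inv
      by (meson equalityI)
  qed
  then show "SG = closure (\<Union>n. SG_verts n)" "SG = (\<Union>i\<in>{1,2,3}. psi i ` SG)"
    using inv unfolding K_def V_def by simp_all
qed

lemma SG_verts_SG: "SG_verts n \<subseteq> SG"
  unfolding SG_eq_closure by (rule order_trans[OF UN_upper[OF UNIV_I] closure_subset])

lemma SG_triangle: "SG \<subseteq> base_triangle"
  unfolding SG_eq_closure using closed_base_triangle SG_verts_triangle
  by (intro closure_minimal UN_least)

section \<open>Cells\<close>

lemma psi_word_Nil [simp]: "psi_word [] x = x"
  by (simp add: psi_word_def)

lemma psi_word_Cons [simp]: "psi_word (i # w) x = psi_word w (psi i x)"
  by (simp add: psi_word_def)

lemma psi_word_append [simp]: "psi_word (u @ w) x = psi_word w (psi_word u x)"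
  by (induction u arbitrary: x) simp_all

lemma dist_psi_word: "dist (psi_word w x) (psi_word w y) = dist x y / 2 ^ length w"
  by (induction w arbitrary: x y) (simp_all add: dist_psi)

lemma psi_word_surj: "\<exists>x. psi_word w x = y"
proof (induction w)
  case (Cons i w)
  then obtain x where "psi_word w x = y" by blast
  then show ?case by (intro exI[of _ "psi_inv i x"]) simp
qed simp

text \<open>A word acts on each coordinate by an integral translation followed by scaling; the
  positions of the letter \<open>k\<close> are the binary digits of \<open>c\<close>.\<close>

lemma bary_psi_word:
  assumes "w \<in> lists {1,2,3}" "k \<in> {1,2,3}"
  shows "\<exists>c::int. \<forall>x. bary k (psi_word w x) = (bary k x + of_int c) / 2 ^ length w"
  using assms(1)
proof (induction w)
  case Nil
  show ?case by (rule exI[of _ 0]) simp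
next
  case (Cons i w)
  then obtain c :: int where c: "\<And>x. bary k (psi_word w x) = (bary k x + of_int c) / 2 ^ length w" by blast
  have i: "i \<in> {1,2,3}" using Cons by simp
  show ?case
    by (rule exI[of _ "(if k = i then 1 else 0) + 2 * c"])
       (simp add: c bary_psi[OF i assms(2)] field_simps)
qed

lemma bary_SG_verts:
  assumes "v \<in> SG_verts n" "k \<in> {1,2,3}"
  shows "\<exists>c::int. bary k v = of_int c / 2 ^ n"
  using assms(1)
proof (induction n arbitrary: v)
  case 0
  then obtain i where "i \<in> {1,2,3}" "v = corner i" by auto
  then show ?case using bary_corner[of i k] assms(2) by (intro exI[of _ "if k = i then 1 else 0"]) simp
next
  case (Suc n)
  then obtain i x where i: "i \<in> {1,2,3}" "x \<in> SG_verts n" "v = psi i x"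
    unfolding SG_verts.simps by blast
  then obtain c :: int where "bary k x = of_int c / 2 ^ n" using Suc.IH by blast
  then show ?case
    unfolding i(3) bary_psi[OF i(1) assms(2)]
    by (intro exI[of _ "c + (if k = i then 2 ^ n else 0)"]) (simp add: field_simps)
qed

lemma psi_word_SG_verts:
  "w \<in> lists {1,2,3} \<Longrightarrow> x \<in> SG_verts m \<Longrightarrow> psi_word w x \<in> SG_verts (length w + m)"
proof (induction w arbitrary: x m)
  case (Cons i w)
  then show ?case using Cons.IH[of "psi i x" "Suc m"] psi_SG_verts[of i x m] by simp
qed simp

abbreviation cell :: "nat list \<Rightarrow> (real \<times> real) set" where
  "cell w \<equiv> psi_word w ` SG"

lemma psi_SG: "i \<in> {1,2,3} \<Longrightarrow> x \<in> SG \<Longrightarrow> psi i x \<in> SG"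
  by (subst SG_invariant, rule UN_I, assumption, rule imageI)

lemma cell_subset: "w \<in> lists {1,2,3} \<Longrightarrow> cell w \<subseteq> SG"
proof -
  have "psi_word w x \<in> SG" if "w \<in> lists {1,2,3}" "x \<in> SG" for w x
    using that by (induction w arbitrary: x) (auto simp: psi_SG)
  then show "w \<in> lists {1,2,3} \<Longrightarrow> cell w \<subseteq> SG" by blast
qed

text \<open>As the first letter acts first, a letter put in front refines a cell, while the last
  letter names the level-one cell around it.\<close>

lemma cell_split: "cell w = (\<Union>i\<in>{1,2,3}. cell (i # w))"
proof -
  have "cell w = psi_word w ` (\<Union>i\<in>{1,2,3}. psi i ` SG)" using SG_invariant by simp
  then show ?thesis by (simp add: image_Un image_image)
qed

lemma cell_append_subset: "u \<in> lists {1,2,3} \<Longrightarrow> cell (u @ w) \<subseteq> cell w"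
proof (rule image_subsetI)
  fix x assume "u \<in> lists {1,2,3}" "x \<in> SG"
  then have "psi_word u x \<in> SG" using cell_subset by blast
  then show "psi_word (u @ w) x \<in> cell w" unfolding psi_word_append by (rule imageI)
qed

definition words :: "nat \<Rightarrow> nat list set" where
  "words m = {w \<in> lists {1,2,3}. length w = m}"

lemma finite_words: "finite (words m)" and card_words: "card (words m) = 3 ^ m"
proof -
  have "words m = {w. set w \<subseteq> {1,2,3} \<and> length w = m}" by (simp only: words_def lists_eq_set mem_Collect_eq)
  moreover have card3: "card {1,2,3::nat} = 3" by simp
  ultimately show "finite (words m)" "card (words m) = 3 ^ m"
    using card_lists_length_eq[of "{1,2,3::nat}" m] finite_lists_length_eq[of "{1,2,3::nat}" m]
    by (simp_all only: card3 finite_insert finite.emptyI)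
qed

lemma SG_eq_Union_cells: "SG = (\<Union>w\<in>words m. cell w)"
proof (induction m)
  case 0
  have "words 0 = {[]}" by (auto simp: words_def)
  then show ?case by simp
next
  case (Suc m)
  show ?case
  proof (intro equalityI UN_least subsetI)
    fix x assume "x \<in> SG"
    then obtain w where w: "w \<in> words m" "x \<in> cell w" using Suc by blast
    then obtain i where i: "i \<in> {1,2,3}" "x \<in> cell (i # w)" using cell_split by blast
    have "i # w \<in> words (Suc m)" using w(1) i(1) by (simp add: words_def del: insert_iff)
    then show "x \<in> (\<Union>w\<in>words (Suc m). cell w)" using i(2) by (rule UN_I)
  next
    fix w x assume "w \<in> words (Suc m)" "x \<in> cell w"
    then show "x \<in> SG" using cell_subset[of w] by (auto simp: words_def)
  qed
qed

text \<open>\<open>p, q, s\<close> are the coordinates of a point in the half-size triangle at the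
  corner (1, 0, 0), and a sum of squares 1/2 means distance 1/2. If \<open>b\<close> is at least 1
  and \<open>a\<close> at most 0, then \<open>b - q\<close> and \<open>p - a\<close> are both at
  least 1/2, which leaves only equality: the point is the midpoint of a side. All other lattice
  points but the corner are too far, up to exchanging \<open>b\<close> and \<open>c\<close>.\<close>

lemma lattice_point_far:
  fixes p q s :: real and a b c :: int
  assumes "p + q + s = 1" "1/2 \<le> p" "0 \<le> q" "0 \<le> s" "a + b + c = 1" "\<not> (a = 1 \<and> b = 0 \<and> c = 0)"
    "(p - a)\<^sup>2 + (q - b)\<^sup>2 + (s - c)\<^sup>2 \<le> 1/2"
  shows "q = 1/2 \<or> s = 1/2"
proof -
  have sq: "1/4 \<le> t\<^sup>2" if "1/2 \<le> t" for t :: real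
    using power_mono[OF that, of 2] by (simp add: power2_eq_square)
  have far: "q = 1/2" if h: "p + q + s = 1" "0 \<le> q" "0 \<le> s" "a + b + c = 1" "1 \<le> b"
      "(p - a)\<^sup>2 + (q - b)\<^sup>2 + (s - c)\<^sup>2 \<le> 1/2" for q s :: real and b c :: int
  proof -
    have q: "1/2 \<le> b - q" using h(1,3,5) assms(2) by linarith
    have q2: "1/4 \<le> (q - b)\<^sup>2" using sq[OF q] by (simp add: power2_commute)
    show ?thesis
    proof (cases "a \<le> 0")
      case True
      then have "1/2 \<le> p - a" using assms(2) by linarith
      then have "1/4 \<le> (p - a)\<^sup>2" by (rule sq)
      then have "(q - b)\<^sup>2 \<le> 1/4" using h(6) zero_le_power2[of "s - c"] by linarith
      then have "(b - q)\<^sup>2 \<le> (1/2)\<^sup>2" by (simp add: power2_commute power_divide)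
      then have "b - q \<le> 1/2" by (rule power2_le_imp_le) simp
      then have "b - q = 1/2" using q by simp
      then have "b = 1" using h(1,2,3,5) assms(2) by linarith
      then show ?thesis using \<open>b - q = 1/2\<close> by simp
    next
      case False
      then have "c \<le> -1" using h(4,5) by linarith
      then have "1 \<le> s - c" using h(3) by linarith
      then have "1 \<le> (s - c)\<^sup>2" by (rule one_le_power)
      then show ?thesis using h(6) q2 zero_le_power2[of "p - a"] by linarith
    qed
  qed
  consider "1 \<le> b" | "1 \<le> c" | "b \<le> 0" "c \<le> 0" by linarith
  then show ?thesis
  proof cases
    case 1
    then show ?thesis using far[of q s b c] assms by simp
  next
    case 2
    then show ?thesis using far[of s q c b] assms by simp
  next
    case 3
    then have "2 \<le> a" using assms(5,6) by presburger
    then have "1 \<le> a - p" using assms(1,3,4) by linarith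
    then have "1 \<le> (a - p)\<^sup>2" by (rule one_le_power)
    then show ?thesis
      using assms(7) zero_le_power2[of "q - b"] zero_le_power2[of "s - c"] by (simp add: power2_commute[of p])
  qed
qed

text \<open>After rescaling by \<open>psi_word w\<close> the vertices have integral barycentric coordinates.\<close>

lemma near_vert_cell:
  assumes w: "w \<in> lists {1,2,3}" "length w = n" and i: "i \<in> {1,2,3}"
    and x: "x \<in> cell (i # w)" "x \<notin> SG_verts (Suc n)"
  shows "near_vert n x = psi_word w (corner i)"
proof -
  from x(1) obtain z where z: "z \<in> SG" "x = psi_word w (psi i z)" by auto
  define y where "y = psi i z"
  have zT: "z \<in> base_triangle" using z(1) SG_triangle by blast
  have dy: "dist y (corner i) \<le> 1/2"
    using dist_corner_le[OF zT i] dist_psi[of i z "corner i"] by (simp add: y_def)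
  have in_ball: "psi_word w (corner i) \<in> near_verts n x"
    unfolding near_verts_def
  proof
    show "psi_word w (corner i) \<in> SG_verts n"
      using psi_word_SG_verts[OF w(1) corner_SG_verts[OF i, of 0]] w(2) by simp
    show "psi_word w (corner i) \<in> cball x ((1/2) ^ (n + 1))"
      using dy by (simp add: z(2) y_def[symmetric] dist_psi_word w(2) power_divide field_simps)
  qed
  have unique: "v = psi_word w (corner i)" if v: "v \<in> near_verts n x" for v
  proof (rule ccontr)
    assume ne: "v \<noteq> psi_word w (corner i)"
    obtain u where u: "psi_word w u = v" using psi_word_surj by blast
    have vV: "v \<in> SG_verts n" and "dist x v \<le> (1/2) ^ (n + 1)" using v by (auto simp: near_verts_def)
    then have "dist y u \<le> 1/2"
      by (simp add: z(2) y_def[symmetric] u[symmetric] dist_psi_word w(2) power_divide field_simps)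
    then have "(dist y u)\<^sup>2 \<le> (1/2)\<^sup>2" by (intro power_mono) auto
    then have d: "(bary 1 y - bary 1 u)\<^sup>2 + (bary 2 y - bary 2 u)\<^sup>2 + (bary 3 y - bary 3 u)\<^sup>2 \<le> 1/2"
      unfolding dist_bary by (simp add: power2_eq_square)
    have int: "\<exists>c::int. bary k u = of_int c" if k: "k \<in> {1,2,3}" for k
    proof -
      obtain a :: int where a: "bary k v = (bary k u + of_int a) / 2 ^ n"
        using bary_psi_word[OF w(1) k] u w(2) by blast
      obtain b :: int where "bary k v = of_int b / 2 ^ n" using bary_SG_verts[OF vV k] by blast
      with a have "bary k u = of_int (b - a)" by simp
      then show ?thesis by blast
    qed
    obtain l r where lr: "distinct [i, l, r]" "{i, l, r} = {1, 2, 3}" using i by (rule other_two)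
    have m: "l \<in> {1,2,3}" "r \<in> {1,2,3}" using lr(2) by blast+
    have sum3: "(\<Sum>k\<in>{1,2,3}. g k) = g i + g l + g r" for g :: "nat \<Rightarrow> real"
      unfolding lr(2)[symmetric] using lr(1) by simp
    obtain ci cl cr :: int where c: "bary i u = of_int ci" "bary l u = of_int cl" "bary r u = of_int cr"
      using int[OF i] int[OF m(1)] int[OF m(2)] by blast
    have su: "ci + cl + cr = 1"
    proof -
      have "bary i u + bary l u + bary r u = 1" using sum3[of "\<lambda>k. bary k u"] bary_sum[of u] by simp
      then show ?thesis unfolding c by linarith
    qed
    have sy: "bary i y + bary l y + bary r y = 1" using sum3[of "\<lambda>k. bary k y"] bary_sum[of y] by simp
    have yi: "1/2 \<le> bary i y" "0 \<le> bary l y" "0 \<le> bary r y"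
      using triangleD[OF zT i] triangleD[OF zT m(1)] triangleD[OF zT m(2)] lr(1)
      unfolding y_def bary_psi[OF i i] bary_psi[OF i m(1)] bary_psi[OF i m(2)] by auto
    have d': "(bary i y - ci)\<^sup>2 + (bary l y - cl)\<^sup>2 + (bary r y - cr)\<^sup>2 \<le> 1/2"
      using d sum3[of "\<lambda>k. (bary k y - bary k u)\<^sup>2"] by (simp add: c)
    have tlr_cases: "k = i \<or> k = l \<or> k = r" if "k \<in> {1,2,3}" for k using that lr(2) by blast
    have uc: "\<not> (ci = 1 \<and> cl = 0 \<and> cr = 0)"
    proof
      assume c1: "ci = 1 \<and> cl = 0 \<and> cr = 0"
      have "u = corner i"
      proof (rule bary_eqI)
        fix k :: nat assume k: "k \<in> {1,2,3}"
        show "bary k u = bary k (corner i)"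
          unfolding bary_corner[OF i k] using tlr_cases[OF k] c c1 lr(1) by auto
      qed
      then show False using ne u by simp
    qed
    \<comment> \<open>The exceptional points of \<open>lattice_point_far\<close> are midpoints of
      sides of the level-\<open>n\<close> cell, hence vertices of level
      \<open>n + 1\<close>.\<close>
    have not_mid: False if h: "a \<in> {1,2,3}" "i \<noteq> a" "bary a y = 1/2" for a
    proof -
      have "bary a z = 1" using h(2,3) unfolding y_def bary_psi[OF i h(1)] by simp
      then have "z = corner a" using bary_ge_one[OF zT h(1)] by simp
      then have "x = psi_word (i # w) (corner a)" using z(2) by simp
      moreover have "psi_word (i # w) (corner a) \<in> SG_verts (Suc n)"
        using psi_word_SG_verts[of "i # w" "corner a" 0] corner_SG_verts[OF h(1), of 0] w i by simp
      ultimately show False using x(2) by simp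
    qed
    show False
      using lattice_point_far[OF sy yi su uc d'] not_mid[OF m(1)] not_mid[OF m(2)] lr(1) by auto
  qed
  have "near_verts n x = {psi_word w (corner i)}" using in_ball unique by blast
  then show ?thesis by (simp add: near_vert_def)
qed

section \<open>Self-similar measures\<close>

lemma SG_vertsE:
  assumes "v \<in> SG_verts n"
  obtains w i where "w \<in> lists {1,2,3}" "i \<in> {1,2,3}" "v = psi_word w (corner i)"
proof -
  have "\<exists>w i. w \<in> lists {1,2,3} \<and> i \<in> {1,2,3} \<and> v = psi_word w (corner i)"
    using assms
  proof (induction n arbitrary: v)
    case 0
    then obtain i where "i \<in> {1,2,3}" "v = corner i" by auto
    then show ?case by (intro exI[of _ "[]"] exI[of _ i]) simp
  next
    case (Suc n)
    then obtain k x where k: "k \<in> {1,2,3}" "x \<in> SG_verts n" "v = psi k x"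
      unfolding SG_verts.simps by blast
    then obtain w i where w: "w \<in> lists {1,2,3}" "i \<in> {1,2,3}" "x = psi_word w (corner i)"
      using Suc.IH by blast
    then show ?case using k by (intro exI[of _ "w @ [k]"] exI[of _ i] conjI) simp_all
  qed
  then show ?thesis using that by blast
qed

locale gasket_measure =
  fixes M :: "(real \<times> real) measure"
  assumes space_M: "space M = SG"
    and sets_M: "sets M = sigma_sets SG (cell ` lists {1,2,3})"
    and emeasure_cell: "w \<in> lists {1,2,3} \<Longrightarrow> emeasure M (cell w) = ennreal ((1/3) ^ length w)"
begin

sublocale finite_measure M
proof
  have "emeasure M (space M) = ennreal 1" using emeasure_cell[of "[]"] by (simp add: space_M)
  then show "emeasure M (space M) \<noteq> \<infinity>" by simp
qed

lemma cell_sets: "w \<in> lists {1,2,3} \<Longrightarrow> cell w \<in> sets M"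
  unfolding sets_M by (intro sigma_sets.Basic imageI)

lemma measure_cell: "w \<in> lists {1,2,3} \<Longrightarrow> measure M (cell w) = (1/3) ^ length w"
  by (rule measure_eq_emeasure_eq_ennreal) (use emeasure_cell in auto)

text \<open>The \<open>3 ^ m\<close> cells of level \<open>m\<close> cover a set of measure one and have measure
  \<open>(1/3) ^ m\<close> each, which leaves no room for overlaps.\<close>

lemma null_overlap:
  assumes "w \<in> words m" "w' \<in> words m" "w \<noteq> w'"
  shows "cell w \<inter> cell w' \<in> null_sets M"
proof -
  have L: "v \<in> lists {1,2,3}" "length v = m" if "v \<in> words m" for v using that by (simp_all only: words_def mem_Collect_eq)
  let ?R = "words m - {w, w'}"
  have sets: "cell w \<in> sets M" "cell w' \<in> sets M" "\<And>v. v \<in> ?R \<Longrightarrow> cell v \<in> sets M"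
    using L(1) assms cell_sets by blast+
  have R: "(\<Union>v\<in>?R. cell v) \<in> sets M"
    using sets(3) finite_words[of m] by (intro sets.finite_UN) auto
  have "1 = measure M SG" using measure_cell[of "[]"] by simp
  also have "SG = (\<Union>v\<in>?R. cell v) \<union> (cell w \<union> cell w')"
    using SG_eq_Union_cells[of m] assms(1,2) by blast
  also have "measure M \<dots> \<le> measure M (\<Union>v\<in>?R. cell v) + measure M (cell w \<union> cell w')"
    using R sets by (intro measure_Un_le sets.Un)
  also have "measure M (\<Union>v\<in>?R. cell v) \<le> (\<Sum>v\<in>?R. measure M (cell v))"
    using sets(3) finite_words[of m] by (intro measure_UNION_le) auto
  also have "\<dots> = (\<Sum>v\<in>?R. (1/3) ^ m)"
    using L measure_cell by (intro sum.cong refl) auto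
  also have "\<dots> = (3 ^ m - 2) * (1/3) ^ m"
  proof -
    have "card ?R + 2 = 3 ^ m"
    proof -
      have "card {w, w'} \<le> card (words m)" using finite_words assms(1,2) by (intro card_mono) auto
      then show ?thesis
        using assms finite_words[of m] card_words[of m] by (simp add: card_Diff_subset)
    qed
    then have "real (card ?R) = 3 ^ m - 2" by (metis add_diff_cancel_right' of_nat_add of_nat_numeral of_nat_power)
    then show ?thesis by simp
  qed
  also have "measure M (cell w \<union> cell w') = 2 * (1/3) ^ m - measure M (cell w \<inter> cell w')"
    using measure_Un3[of "cell w" M "cell w'"] sets L[OF assms(1)] L[OF assms(2)] measure_cell
    by (simp add: fmeasurable_eq_sets)
  finally have "measure M (cell w \<inter> cell w') \<le> 0"
    by (simp add: algebra_simps flip: power_mult_distrib)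
  then have "measure M (cell w \<inter> cell w') = 0" using measure_nonneg[of M "cell w \<inter> cell w'"] by linarith
  then show ?thesis using sets(1,2) by (intro null_setsI) (auto simp: emeasure_eq_measure)
qed

text \<open>\<open>psi i\<close> fixes \<open>corner i\<close>, so \<open>v\<close> lies in the
  cells of all words \<open>replicate m i @ w\<close>; these shrink to \<open>v\<close>, and their
  measures tend to 0.\<close>

lemma vertex_null:
  assumes "v \<in> SG_verts n"
  shows "{v} \<in> null_sets M"
proof -
  from assms obtain w i where w: "w \<in> lists {1,2,3}" and i: "i \<in> {1,2,3}"
    and v: "v = psi_word w (corner i)" by (rule SG_vertsE)
  define C where "C m = cell (replicate m i @ w)" for m
  have rep: "psi_word (replicate m i) (corner i) = corner i" for m by (induction m) simp_all
  have L: "replicate m i @ w \<in> lists {1,2,3}" for m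
    using w i by (simp only: append_in_lists_conv in_lists_conv_set set_replicate_conv_if) auto
  have "corner i \<in> SG" using SG_verts_SG corner_SG_verts[OF i] by blast
  then have vC: "v \<in> C m" for m unfolding C_def v by (intro image_eqI[of _ _ "corner i"]) (simp_all add: rep)
  have "y = v" if y: "\<And>m. y \<in> C m" for y
  proof -
    have "dist y v \<le> (1/2) ^ m" for m
    proof -
      from y[of m] obtain x where x: "x \<in> SG" "y = psi_word (replicate m i @ w) x" unfolding C_def by blast
      have "dist y v = dist y (psi_word (replicate m i @ w) (corner i))" by (simp add: v rep)
      also have "\<dots> = dist x (corner i) / 2 ^ (m + length w)" unfolding x(2) dist_psi_word by simp
      also have "\<dots> \<le> 1 / 2 ^ (m + length w)"
        using dist_corner_le[of x i] x(1) SG_triangle i by (intro divide_right_mono) auto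
      also have "\<dots> \<le> 1 / 2 ^ m" by (intro divide_left_mono power_increasing) auto
      finally show ?thesis by (simp add: power_divide)
    qed
    moreover have "(\<lambda>m. (1/2::real) ^ m) \<longlonglongrightarrow> 0" by (rule LIMSEQ_realpow_zero) auto
    ultimately have "dist y v \<le> 0" by (intro LIMSEQ_le_const[of "\<lambda>m. (1/2) ^ m"]) auto
    then show ?thesis by simp
  qed
  then have "{v} = (\<Inter>m. C m)" using vC by blast
  moreover have C: "C m \<in> sets M" for m unfolding C_def by (rule cell_sets[OF L])
  ultimately have sv: "{v} \<in> sets M" by auto
  have "measure M {v} \<le> (1/3) ^ m" for m
  proof -
    have "measure M {v} \<le> measure M (C m)" using vC C by (intro finite_measure_mono) auto
    also have "\<dots> = (1/3) ^ (m + length w)" unfolding C_def measure_cell[OF L] by simp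
    also have "\<dots> \<le> (1/3) ^ m" by (intro power_decreasing) auto
    finally show ?thesis .
  qed
  moreover have "(\<lambda>m. (1/3::real) ^ m) \<longlonglongrightarrow> 0" by (rule LIMSEQ_realpow_zero) auto
  ultimately have "measure M {v} \<le> 0" by (intro LIMSEQ_le_const[of "\<lambda>m. (1/3) ^ m"]) auto
  then have "measure M {v} = 0" using measure_nonneg[of M "{v}"] by linarith
  then show ?thesis using sv by (intro null_setsI) (auto simp: emeasure_eq_measure)
qed

lemma subset_SG_verts_null:
  assumes "N \<subseteq> SG_verts n"
  shows "N \<in> null_sets M"
proof -
  have "(\<Union>v\<in>N. {v}) \<in> null_sets M"
    using assms vertex_null finite_subset[OF assms finite_SG_verts]
    by (intro null_sets_UN') (auto intro: countable_finite)
  then show ?thesis by simp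
qed

text \<open>Off the finite set of vertices of level \<open>n + 1\<close> the function is constant on
  each cell of level \<open>n + 1\<close>, and every set of such vertices is null, hence
  measurable.\<close>

lemma continuation_measurable [measurable]: "continuation n f \<in> borel_measurable M"
proof -
  let ?g = "\<lambda>x. f (near_vert n x)"
  have "?g -` {a} \<inter> space M \<in> sets M" for a
  proof -
    let ?N = "SG_verts (Suc n)"
    define J where "J = {iw \<in> {1,2,3} \<times> words n. f (psi_word (snd iw) (corner (fst iw))) = a}"
    have finJ: "finite J" unfolding J_def using finite_words[of n] by simp
    have JD: "fst iw \<in> {1,2,3}" "snd iw \<in> lists {1,2,3}" "length (snd iw) = n"
      "f (psi_word (snd iw) (corner (fst iw))) = a" if "iw \<in> J" for iw
      using that unfolding J_def words_def by auto
    have "?g -` {a} \<inter> space M = ((\<Union>iw\<in>J. cell (fst iw # snd iw)) - ?N) \<union> (?g -` {a} \<inter> ?N)"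
    proof (intro equalityI subsetI)
      fix x assume x: "x \<in> ?g -` {a} \<inter> space M"
      show "x \<in> ((\<Union>iw\<in>J. cell (fst iw # snd iw)) - ?N) \<union> (?g -` {a} \<inter> ?N)"
      proof (cases "x \<in> ?N")
        case False
        have "x \<in> SG" using x by (simp add: space_M)
        then obtain w where w: "w \<in> words n" "x \<in> cell w" using SG_eq_Union_cells[of n] by blast
        then obtain i where i: "i \<in> {1,2,3}" "x \<in> cell (i # w)" using cell_split by blast
        have "w \<in> lists {1,2,3}" "length w = n" using w(1) unfolding words_def by blast+
        then have "near_vert n x = psi_word w (corner i)" using i False by (rule near_vert_cell)
        then have "(i, w) \<in> J" using x i(1) w(1) by (simp add: J_def)
        then show ?thesis using i(2) False by force
      qed (use x in blast)
    next
      fix x assume x: "x \<in> ((\<Union>iw\<in>J. cell (fst iw # snd iw)) - ?N) \<union> (?g -` {a} \<inter> ?N)"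
      then consider iw where "iw \<in> J" "x \<in> cell (fst iw # snd iw)" "x \<notin> ?N" | "x \<in> ?g -` {a} \<inter> ?N" by blast
      then show "x \<in> ?g -` {a} \<inter> space M"
      proof cases
        case 1
        have "x \<in> SG"
          using cell_subset[of "fst iw # snd iw"] 1(2) JD(1,2)[OF 1(1)] by (simp only: Cons_in_lists_iff) blast
        moreover have "near_vert n x = psi_word (snd iw) (corner (fst iw))"
          by (rule near_vert_cell[OF JD(2,3,1)[OF 1(1)] 1(2,3)])
        ultimately show ?thesis using JD(4)[OF 1(1)] by (simp add: space_M)
      next
        case 2
        then show ?thesis using SG_verts_SG[of "Suc n"] space_M by blast
      qed
    qed
    moreover have "(\<Union>iw\<in>J. cell (fst iw # snd iw)) \<in> sets M"
      using finJ JD(1,2) by (intro sets.finite_UN cell_sets) (simp_all only: Cons_in_lists_iff)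
    moreover have "?N \<in> sets M" "?g -` {a} \<inter> ?N \<in> sets M"
      using subset_SG_verts_null[of ?N "Suc n"] subset_SG_verts_null[of "?g -` {a} \<inter> ?N" "Suc n"] by auto
    ultimately show ?thesis by simp
  qed
  then have "?g \<in> measurable M (count_space UNIV)"
    by (subst measurable_count_space_eq_countable) auto
  then show ?thesis unfolding continuation_def by measurable
qed

lemma integral_cell_split:
  fixes f :: "real \<times> real \<Rightarrow> real"
  assumes "w \<in> lists {1,2,3}" "integrable M f"
  shows "(LINT x:cell w|M. f x) = (\<Sum>i\<in>{1,2,3}. LINT x:cell (i # w)|M. f x)"
proof -
  have L: "i # w \<in> lists {1,2,3}" if "i \<in> {1,2,3}" for i using assms(1) that by (simp only: Cons_in_lists_iff)
  have sets: "cell (1 # w) \<in> sets M" "cell (2 # w) \<in> sets M" "cell (3 # w) \<in> sets M"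
    using L cell_sets by (meson insertI1 insertI2)+
  have int: "set_integrable M A f" if "A \<in> sets M" for A
    unfolding set_integrable_def using integrable_mult_indicator[OF that assms(2)] .
  have disj: "AE x in M. \<not> (x \<in> cell (i # w) \<and> x \<in> cell (k # w))"
    if "i \<in> {1,2,3}" "k \<in> {1,2,3}" "i \<noteq> k" for i k
  proof -
    have "cell (i # w) \<inter> cell (k # w) \<in> null_sets M"
      using L[OF that(1)] L[OF that(2)] that(3)
      by (intro null_overlap[of _ "Suc (length w)"]) (simp_all only: words_def mem_Collect_eq length_Cons, simp)
    from AE_not_in[OF this] show ?thesis by eventually_elim blast
  qed
  have disj12: "AE x in M. \<not> (x \<in> cell (1 # w) \<and> x \<in> cell (2 # w))"
    and disj13: "AE x in M. \<not> (x \<in> cell (1 # w) \<and> x \<in> cell (3 # w))"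
    and disj23: "AE x in M. \<not> (x \<in> cell (2 # w) \<and> x \<in> cell (3 # w))"
    by (rule disj; simp)+
  have "cell w = cell (1 # w) \<union> (cell (2 # w) \<union> cell (3 # w))"
    using cell_split[of w] by blast
  also have "(LINT x:\<dots>|M. f x)
      = (LINT x:cell (1 # w)|M. f x) + (LINT x:cell (2 # w) \<union> cell (3 # w)|M. f x)"
  proof (rule set_integral_Un_AE)
    show "AE x in M. \<not> (x \<in> cell (1 # w) \<and> x \<in> cell (2 # w) \<union> cell (3 # w))"
      using disj12 disj13 by eventually_elim blast
  qed (intro sets int sets.Un)+
  also have "(LINT x:cell (2 # w) \<union> cell (3 # w)|M. f x)
      = (LINT x:cell (2 # w)|M. f x) + (LINT x:cell (3 # w)|M. f x)"
    by (rule set_integral_Un_AE[OF disj23 sets(2,3) int[OF sets(2)] int[OF sets(3)]])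
  finally show ?thesis by simp
qed

text \<open>\<open>cell (i # w)\<close> is the third of \<open>cell w\<close> at its corner
  \<open>i\<close>, and this corner is the only vertex in the ball around almost every point
  there.\<close>

lemma integral_continuation_cell:
  assumes "w \<in> lists {1,2,3}" "length w = n" "i \<in> {1,2,3}"
  shows "(LINT x:cell (i # w)|M. continuation n f x) = (1/3) ^ (n + 1) * real (f (psi_word w (corner i)))"
proof -
  let ?c = "real (f (psi_word w (corner i)))"
  have L: "i # w \<in> lists {1,2,3}" using assms by (simp only: Cons_in_lists_iff)
  have "AE x in M. x \<notin> SG_verts (Suc n)" 
    by (rule AE_not_in[OF subset_SG_verts_null[OF subset_refl]])
  then have "AE x\<in>cell (i # w) in M. continuation n f x = ?c"
  proof eventually_elim
    case (elim x)
    then show ?case using near_vert_cell[OF assms, of x] by (auto simp: continuation_def)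
  qed
  then have "(LINT x:cell (i # w)|M. continuation n f x) = (LINT x:cell (i # w)|M. ?c)"
    by (intro set_lebesgue_integral_cong_AE cell_sets[OF L]) auto
  also have "\<dots> = measure M (cell (i # w)) *\<^sub>R ?c"
    using cell_sets[OF L] by (intro set_integral_const) auto
  also have "\<dots> = (1/3) ^ (n + 1) * ?c"
    unfolding measure_cell[OF L] using assms(2) by simp
  finally show ?thesis .
qed

section \<open>From cells to measurable sets\<close>

lemma abs_integral_le:
  fixes f :: "real \<times> real \<Rightarrow> real"
  assumes "f \<in> borel_measurable M" "\<And>x. \<bar>f x\<bar> \<le> B" "A \<in> sets M"
  shows "\<bar>LINT x:A|M. f x\<bar> \<le> B * measure M A"
proof -
  have int: "integrable M f" using assms(1,2) by (intro integrable_const_bound[of _ B]) auto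
  have "\<bar>LINT x:A|M. f x\<bar> \<le> (LINT x|M. \<bar>indicator A x *\<^sub>R f x\<bar>)"
    unfolding set_lebesgue_integral_def by (rule integral_abs_bound)
  also have "\<dots> \<le> (LINT x|M. indicator A x *\<^sub>R B)"
  proof (rule integral_mono)
    show "integrable M (\<lambda>x. \<bar>indicator A x *\<^sub>R f x\<bar>)"
      using integrable_mult_indicator[OF assms(3) int] by (rule integrable_abs)
    show "integrable M (\<lambda>x. indicat_real A x *\<^sub>R B)"
      using assms(3) by (intro integrable_mult_indicator) auto
    show "\<bar>indicat_real A x *\<^sub>R f x\<bar> \<le> indicat_real A x *\<^sub>R B" for x
      using assms(2)[of x] by (auto simp: indicator_def)
  qed
  also have "\<dots> = B * measure M A"
    using set_integral_const[of A M B] assms(3) unfolding set_lebesgue_integral_def by simp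
  finally show ?thesis .
qed

text \<open>Adjacent cells meet in a point, which is not a cell; hence the null sets. The last
  letters of the longer word name a cell of the same level as the other one; it equals that cell or
  meets it in a null set.\<close>

lemma Int_stable_cells: "Int_stable (cell ` lists {1,2,3} \<union> null_sets M)"
proof -
  have cells: "cell w \<inter> cell w' \<in> cell ` lists {1,2,3} \<union> null_sets M"
    if w: "w \<in> lists {1,2,3}" "w' \<in> lists {1,2,3}" "length w \<le> length w'" for w w'
  proof -
    define u where "u = take (length w' - length w) w'"
    define v where "v = drop (length w' - length w) w'"
    have uv: "w' = u @ v" "length v = length w" using w(3) by (auto simp: u_def v_def)
    have Luv: "u \<in> lists {1,2,3}" "v \<in> lists {1,2,3}"
      using w(2) unfolding uv(1) by (simp_all only: append_in_lists_conv)
    have sub: "cell w' \<subseteq> cell v" unfolding uv(1) by (rule cell_append_subset[OF Luv(1)])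
    show ?thesis
    proof (cases "v = w")
      case True
      then have "cell w \<inter> cell w' = cell w'" using sub by blast
      then show ?thesis using w(2) by simp
    next
      case False
      have "cell w \<inter> cell v \<in> null_sets M"
        using w(1) Luv(2) uv(2) False
        by (intro null_overlap[of _ "length w"]) (simp_all only: words_def mem_Collect_eq, simp)
      moreover have "cell w \<inter> cell w' \<in> sets M" using w cell_sets by (intro sets.Int) auto
      ultimately have "cell w \<inter> cell w' \<in> null_sets M"
        by (rule null_sets_subset) (use sub in blast)
      then show ?thesis by simp
    qed
  qed
  show ?thesis
  proof (rule Int_stableI)
    fix a b
    assume ab: "a \<in> cell ` lists {1,2,3} \<union> null_sets M" "b \<in> cell ` lists {1,2,3} \<union> null_sets M"
    have s: "a \<in> sets M" "b \<in> sets M" using ab cell_sets by blast+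
    show "a \<inter> b \<in> cell ` lists {1,2,3} \<union> null_sets M"
    proof (cases "a \<in> null_sets M \<or> b \<in> null_sets M")
      case True
      then have "a \<inter> b \<in> null_sets M" using s null_set_Int1 null_set_Int2 by blast
      then show ?thesis by simp
    next
      case False
      then obtain w w' where w: "w \<in> lists {1,2,3}" "w' \<in> lists {1,2,3}" "a = cell w" "b = cell w'"
        using ab by blast
      then show ?thesis
        using cells[of w w'] cells[of w' w] by (metis Int_commute linear)
    qed
  qed
qed

text \<open>Dynkin induction: the sets with this limit are closed under complements and countable
  disjoint unions. On null sets both sides vanish.\<close>

lemma tendsto_integral_of_cells:
  fixes F :: "nat \<Rightarrow> real \<times> real \<Rightarrow> real"
  assumes meas: "\<And>n. F n \<in> borel_measurable M" and bound: "\<And>n x. \<bar>F n x\<bar> \<le> B"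
    and cells: "\<And>w. w \<in> lists {1,2,3} \<Longrightarrow>
      (\<lambda>n. LINT x:cell w|M. F n x) \<longlonglongrightarrow> c * measure M (cell w)"
    and C: "C \<in> sets M"
  shows "(\<lambda>n. LINT x:C|M. F n x) \<longlonglongrightarrow> c * measure M C"
proof -
  let ?G = "cell ` lists {1,2,3} \<union> null_sets M"
  have G: "?G \<subseteq> sets M" using cell_sets by blast
  then have GP: "?G \<subseteq> Pow SG" using sets.sets_into_space[of _ M] unfolding space_M by blast
  have sub: "sigma_sets SG ?G \<subseteq> sets M"
    using sets.sigma_sets_subset[OF G] unfolding space_M .
  have int: "integrable M (F n)" for n using meas bound by (intro integrable_const_bound[of _ B]) auto
  have sint: "set_integrable M A (F n)" if "A \<in> sets M" for A n
    unfolding set_integrable_def using integrable_mult_indicator[OF that int] .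
  have "C \<in> sigma_sets SG ?G" using C unfolding sets_M by (rule sigma_sets_mono'[THEN subsetD, rotated]) blast
  with Int_stable_cells GP show ?thesis
  proof (induction rule: sigma_sets_induct_disjoint)
    case (basic A)
    then show ?case
    proof
      assume "A \<in> null_sets M"
      then have "measure M A = 0" "A \<in> sets M" by (auto simp: measure_def)
      then have "(LINT x:A|M. F n x) = 0" for n
        using abs_integral_le[OF meas bound, of A n] by simp
      then show ?thesis using \<open>measure M A = 0\<close> by simp
    qed (use cells in blast)
  next
    case empty
    then show ?case by (simp add: set_lebesgue_integral_def)
  next
    case (compl A)
    have A: "A \<in> sets M" using compl(1) sub by blast
    have SG: "SG \<in> sets M" using sets.top[of M] unfolding space_M .
    have "A \<subseteq> SG" using sets.sets_into_space[OF A] unfolding space_M .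
    then have SGA: "SG = (SG - A) \<union> A" by blast
    have D: "SG - A \<in> sets M" using SG A by simp
    have "(LINT x:SG|M. F n x) = (LINT x:SG - A|M. F n x) + (LINT x:A|M. F n x)" for n
      by (subst SGA, rule set_integral_Un) (use sint D A in auto)
    then have eq: "(LINT x:SG - A|M. F n x) = (LINT x:SG|M. F n x) - (LINT x:A|M. F n x)" for n
      by (simp add: algebra_simps)
    have "measure M (SG - A) = measure M SG - measure M A"
      using A SG \<open>A \<subseteq> SG\<close> by (intro finite_measure_Diff)
    moreover have "(\<lambda>n. LINT x:SG|M. F n x) \<longlonglongrightarrow> c * measure M SG" using cells[of "[]"] by simp
    ultimately show ?case unfolding eq using tendsto_diff[OF _ compl(2)] by (simp only: right_diff_distrib)
  next
    case (union A)
    have A: "A i \<in> sets M" for i using union(2) sub by blast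
    have disj: "A i \<inter> A j = {}" if "i \<noteq> j" for i j
      using union(1) that by (auto simp: disjoint_family_on_def)
    have UA: "(\<Union>i. A i) \<in> sets M" using A by auto
    have eq: "(LINT x:(\<Union>i. A i)|M. F n x) = (\<Sum>i. LINT x:A i|M. F n x)" for n
      by (rule lebesgue_integral_countable_add[OF A disj sint[OF UA]])
    have sums: "(\<lambda>i. measure M (A i)) sums measure M (\<Union>i. A i)"
      using A union(1) by (intro finite_measure_UNION) auto
    have "(\<lambda>n. \<Sum>i. LINT x:A i|M. F n x) \<longlonglongrightarrow> (\<Sum>i. c * measure M (A i))"
    \<comment> \<open>Tannery's theorem exchanges limit and series; the dominating terms
      \<open>B * measure M (A k)\<close> are summable since the measure is finite.\<close>
    proof (intro conjunct2[OF conjunct2[OF tannerys_theorem]])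
      show "(\<lambda>n. LINT x:A k|M. F n x) \<longlonglongrightarrow> c * measure M (A k)" for k by (rule union(3))
      show "\<forall>\<^sub>F (k, n) in at_top \<times>\<^sub>F sequentially. norm (LINT x:A k|M. F n x) \<le> B * measure M (A k)"
        using abs_integral_le[OF meas bound A] by (intro always_eventually) auto
      show "summable (\<lambda>k. B * measure M (A k))" using sums by (intro summable_mult sums_summable)
    qed simp
    moreover have "(\<Sum>i. c * measure M (A i)) = c * measure M (\<Union>i. A i)"
      using sums_mult[OF sums, of c] by (simp add: sums_iff)
    ultimately show ?case unfolding eq by simp
  qed
qed

end

section \<open>The concrete measure\<close>

lemma SG_measure_space: "space SG_measure = SG"
  and SG_measure_sets: "sets SG_measure = sigma_sets SG (cell ` lists {1,2,3})"
proof -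
  have "cell ` lists {1,2,3} \<subseteq> Pow SG" using cell_subset by blast
  then show "space SG_measure = SG" "sets SG_measure = sigma_sets SG (cell ` lists {1,2,3})"
    unfolding SG_measure_def by (rule space_extend_measure, rule sets_extend_measure)
qed

text \<open>If no measure had the prescribed values on the cells, \<^const>\<open>extend_measure\<close> would yield the null
  measure, for which the convergence is trivial. Hence its existence need not be proved.\<close>

lemma SG_measure_cases: "gasket_measure SG_measure \<or> emeasure SG_measure SG = 0"
proof (cases "\<exists>\<mu>'. (\<forall>w\<in>lists {1,2,3}. \<mu>' (cell w) = ennreal ((1/3) ^ length w)) \<and>
    measure_space SG (sigma_sets SG (cell ` lists {1,2,3})) \<mu>'")
  case True
  then obtain \<mu>' where mu: "\<And>w. w \<in> lists {1,2,3} \<Longrightarrow> \<mu>' (cell w) = ennreal ((1/3) ^ length w)"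
    "measure_space SG (sigma_sets SG (cell ` lists {1,2,3})) \<mu>'" by blast
  have cells: "cell ` lists {1,2,3} \<subseteq> Pow SG" using cell_subset by blast
  have "gasket_measure SG_measure"
  proof
    fix w :: "nat list" assume "w \<in> lists {1,2,3}"
    then show "emeasure SG_measure (cell w) = ennreal ((1/3) ^ length w)"
      using emeasure_extend_measure[OF SG_measure_def mu(1) cells, of w] mu(2)
      unfolding measure_space_def SG_measure_sets by blast
  qed (rule SG_measure_space SG_measure_sets)+
  then show ?thesis ..
next
  case False
  then have eq: "SG_measure = sigma SG (cell ` lists {1,2,3})"
    unfolding SG_measure_def extend_measure_def by (simp only: if_False simp_thms)
  have "emeasure SG_measure SG = 0" unfolding eq emeasure_sigma by (rule refl)
  then show ?thesis ..
qed

section \<open>Sums over cells\<close>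

text \<open>A sum over all level-\<open>k\<close> cells and their corners: a vertex in two cells
  counts twice.\<close>

primrec cellsum :: "nat \<Rightarrow> (real \<times> real \<Rightarrow> real) \<Rightarrow> real" where
  "cellsum 0 g = (\<Sum>i\<in>{1,2,3}. g (corner i))"
| "cellsum (Suc k) g = (\<Sum>i\<in>{1,2,3}. cellsum k (\<lambda>x. g (psi i x)))"

lemma cellsum_mono:
  assumes "\<And>x. x \<in> SG_verts k \<Longrightarrow> g x \<le> h x"
  shows "cellsum k g \<le> cellsum k h"
  using assms
proof (induction k arbitrary: g h)
  case 0
  show ?case unfolding cellsum.simps by (rule sum_mono) (use 0 corner_SG_verts in blast)
next
  case (Suc k)
  show ?case
    unfolding cellsum.simps by (intro sum_mono Suc.IH Suc.prems psi_SG_verts)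
qed

lemma cellsum_cong:
  assumes "\<And>x. x \<in> SG_verts k \<Longrightarrow> g x = h x"
  shows "cellsum k g = cellsum k h"
  using assms by (intro antisym cellsum_mono) simp_all

lemma cellsum_add: "cellsum k (\<lambda>x. g x + h x) = cellsum k g + cellsum k h"
  by (induction k arbitrary: g h) (simp_all add: algebra_simps)

lemma cellsum_diff: "cellsum k (\<lambda>x. g x - h x) = cellsum k g - cellsum k h"
  by (induction k arbitrary: g h) (simp_all add: algebra_simps)

lemma cellsum_const: "cellsum k (\<lambda>_. c) = 3 * 3 ^ k * c"
  by (induction k) (simp_all add: algebra_simps)

text \<open>A corner of the gasket lies in a single level-\<open>k\<close> cell.\<close>

lemma cellsum_corner:
  assumes "i \<in> {1,2,3}"
  shows "cellsum k (\<lambda>x. of_bool (x = corner i)) = 1"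
proof (induction k)
  case 0
  have "cellsum 0 (\<lambda>x. of_bool (x = corner i)) = (\<Sum>m\<in>{1,2,3}. if m = i then 1 else 0)"
    unfolding cellsum.simps using assms corner_eq_iff by (intro sum.cong) auto
  also have "\<dots> = 1" using assms by (subst sum.delta) auto
  finally show ?case .
next
  case (Suc k)
  have "cellsum k (\<lambda>x. of_bool (psi m x = corner i)) = (if m = i then 1 else 0)"
    if m: "m \<in> {1,2,3}" for m
  proof -
    have "psi m x = corner i \<longleftrightarrow> m = i \<and> x = corner i" if x: "x \<in> SG_verts k" for x
    proof
      assume h: "psi m x = corner i"
      then have "psi m x \<in> corner ` {1,2,3}" using assms by blast
      then have "x = corner m"
        using psi_eq_corner_imp[OF _ m] x SG_verts_triangle by blast
      then show "m = i \<and> x = corner i" using h corner_eq_iff[OF m assms] by auto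
    qed simp
    then have "cellsum k (\<lambda>x. of_bool (psi m x = corner i)) = cellsum k (\<lambda>x. of_bool (m = i \<and> x = corner i))"
      by (intro cellsum_cong) simp
    then show ?thesis using Suc cellsum_const[of k 0] by (cases "m = i") simp_all
  qed
  then have "cellsum (Suc k) (\<lambda>x. of_bool (x = corner i)) = (\<Sum>m\<in>{1,2,3}. if m = i then 1 else 0)"
    unfolding cellsum.simps by (intro sum.cong refl)
  also have "\<dots> = 1" using assms by (subst sum.delta) auto
  finally show ?case .
qed

text \<open>There are \<open>3 ^ k\<close> apexes, one per cell; each lies in two cells, except the
  gasket corner \<open>t\<close>, which lies in one.\<close>

lemma cellsum_apexes:
  assumes "t \<in> {1,2,3}"
  shows "cellsum k (\<lambda>x. of_bool (x \<in> apexes k t)) = 2 * 3 ^ k - 1"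
proof (induction k)
  case 0
  show ?case using cellsum_corner[OF assms, of 0] by simp
next
  case (Suc k)
  obtain l r where lr: "distinct [t, l, r]" "{t, l, r} = {1, 2, 3}" using assms by (rule other_two)
  have m: "l \<in> {1,2,3}" "r \<in> {1,2,3}" using lr(2) by blast+
  have *: "cellsum k (\<lambda>x. of_bool (psi i x \<in> apexes (Suc k) t))
      = (2 * 3 ^ k - 1) + (if i = t then 2 else 0)" if i: "i \<in> {1,2,3}" for i
  proof (cases "i = t")
    case False
    then have "cellsum k (\<lambda>x. of_bool (psi i x \<in> apexes (Suc k) t)) = cellsum k (\<lambda>x. of_bool (x \<in> apexes k t))"
      using psi_mem_apexes_iff[OF i assms] by (intro cellsum_cong) simp
    then show ?thesis using Suc False by simp
  next
    case True
    have "cellsum k (\<lambda>x. of_bool (psi i x \<in> apexes (Suc k) t))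
        = cellsum k (\<lambda>x. of_bool (x \<in> apexes k t) + (of_bool (x = corner l) + of_bool (x = corner r)))"
    proof (rule cellsum_cong)
      fix x assume x: "x \<in> SG_verts k"
      have "psi i x \<in> apexes (Suc k) t \<longleftrightarrow> x \<in> apexes k t \<or> x = corner l \<or> x = corner r"
        unfolding psi_mem_apexes_iff[OF i assms x] lr(2)[symmetric]
        using True corner_apexes_iff[OF assms assms, of k] by auto
      moreover have "corner l \<notin> apexes k t" "corner r \<notin> apexes k t" "corner l \<noteq> corner r"
        using corner_apexes_iff[OF m(1) assms] corner_apexes_iff[OF m(2) assms] corner_eq_iff[OF m] lr(1)
        by auto
      ultimately show "of_bool (psi i x \<in> apexes (Suc k) t)
          = of_bool (x \<in> apexes k t) + (of_bool (x = corner l) + of_bool (x = corner r) :: real)" by auto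
    qed
    then show ?thesis using True Suc by (simp add: cellsum_add cellsum_corner[OF m(1)] cellsum_corner[OF m(2)])
  qed
  have "cellsum (Suc k) (\<lambda>x. of_bool (x \<in> apexes (Suc k) t))
      = (\<Sum>i\<in>{1,2,3}. (2 * 3 ^ k - 1) + (if i = t then 2 else 0))"
    unfolding cellsum.simps(2) by (intro sum.cong refl *)
  also have "\<dots> = 3 * (2 * 3 ^ k - 1) + (\<Sum>i\<in>{1,2,3}. if i = t then 2 else 0)"
    unfolding sum.distrib by simp
  also have "(\<Sum>i\<in>{1,2,3}. if i = t then 2 else (0::real)) = 2" using assms by (subst sum.delta) auto
  finally show ?case by simp
qed

text \<open>Whether an inner vertex of a cell is an apex is decided inside that cell; only at the
  corners of a cell can a neighbouring cell interfere.\<close>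

lemma psi_word_inner:
  assumes "u \<in> lists {1,2,3}" "t \<in> {1,2,3}" "x \<in> SG_verts k" "x \<notin> corner ` {1,2,3}"
  shows "psi_word u x \<notin> corner ` {1,2,3} \<and>
    (psi_word u x \<in> apexes (length u + k) t \<longleftrightarrow> x \<in> apexes k t)"
  using assms(1,3,4)
proof (induction u arbitrary: x k rule: list.induct)
  case (Cons i u)
  have i: "i \<in> {1,2,3}" "u \<in> lists {1,2,3}" using Cons.prems(1) by (simp_all only: Cons_in_lists_iff)
  have "psi i x \<in> apexes (Suc k) t \<longleftrightarrow> x \<in> apexes k t"
    using psi_mem_apexes_iff[OF i(1) assms(2) Cons.prems(2)] Cons.prems(3) by blast
  then show ?case
    using Cons.IH[OF i(2) psi_SG_verts[OF i(1) Cons.prems(2)] psi_inner_notin[OF i(1) Cons.prems(2,3)]]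
    by (simp only: psi_word_Cons length_Cons add_Suc_right add_Suc simp_thms)
qed simp

text \<open>The last letter \<open>t\<close> fixes the orientation. Counting 2 everywhere and 1 more
  at the apexes gives \<open>8 * 3 ^ k - 1\<close>. The true values differ from this only at the
  three corners of the cell, by at most 1 each, so the error is at most 1 + 3.\<close>

lemma cellsum_id_conf:
  assumes "u \<in> lists {1,2,3}" "t \<in> {1,2,3}" "length u + k = j"
  shows "\<bar>cellsum k (\<lambda>x. real (id_conf j (psi_word (u @ [t]) x))) - 8 * 3 ^ k\<bar> \<le> 4"
proof -
  let ?e = "\<lambda>x. real (id_conf j (psi_word (u @ [t]) x))"
  let ?a = "\<lambda>x. 2 + of_bool (x \<in> apexes k t) :: real"
  let ?c = "\<lambda>x. of_bool (x = corner 1) + (of_bool (x = corner 2) + of_bool (x = corner 3)) :: real"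
  have a: "cellsum k ?a = 8 * 3 ^ k - 1"
    unfolding cellsum_add cellsum_const cellsum_apexes[OF assms(2)] by simp
  have c: "cellsum k ?c = 3" unfolding cellsum_add by (simp add: cellsum_corner)
  have "\<bar>?e x - ?a x\<bar> \<le> ?c x" if x: "x \<in> SG_verts k" for x
  proof (cases "x \<in> corner ` {1,2,3}")
    case True
    have y: "psi_word u x \<in> SG_verts j" using psi_word_SG_verts[OF assms(1) x] assms(3) by simp
    have "psi_word (u @ [t]) x \<in> SG_verts (Suc j)" using psi_SG_verts[OF assms(2) y] by simp
    then have "2 \<le> ?e x" "?e x \<le> 3"
      using id_conf_bounds(1)[of "psi_word (u @ [t]) x" j] id_conf_bounds(2)[of j "psi_word (u @ [t]) x"]
      by linarith+
    moreover have "1 \<le> ?c x" using True by auto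
    ultimately show ?thesis by (auto simp: abs_le_iff)
  next
    case False
    have y: "psi_word u x \<in> SG_verts j" using psi_word_SG_verts[OF assms(1) x] assms(3) by simp
    note inn = psi_word_inner[OF assms(1,2) x False]
    have "id_conf j (psi_word (u @ [t]) x) = (if psi_word u x \<in> apexes j t then 3 else 2)"
      using id_conf_inner[OF assms(2) y conjunct1[OF inn]] by simp
    also have "psi_word u x \<in> apexes j t \<longleftrightarrow> x \<in> apexes k t" using conjunct2[OF inn] assms(3) by simp
    finally have "?e x = ?a x" by simp
    then show ?thesis by simp
  qed
  then have "cellsum k (\<lambda>x. ?e x - ?a x) \<le> cellsum k ?c" "cellsum k (\<lambda>x. ?a x - ?e x) \<le> cellsum k ?c"
    by (intro cellsum_mono; fastforce simp: abs_le_iff)+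
  then show ?thesis unfolding cellsum_diff a c by linarith
qed

section \<open>Limits of the integrals over cells\<close>

context gasket_measure
begin

text \<open>The value at each corner of a level-\<open>n\<close> cell is taken almost everywhere on
  one cell of level \<open>n + 1\<close>, of measure \<open>(1/3) ^ (n + 1)\<close>.\<close>

lemma integral_continuation_cellsum:
  assumes "w \<in> lists {1,2,3}" "length w + k = n" "\<And>x. f x \<le> B"
  shows "(LINT x:cell w|M. continuation n f x)
    = (1/3) ^ (n + 1) * cellsum k (\<lambda>x. real (f (psi_word w x)))"
  using assms(1,2)
proof (induction k arbitrary: w)
  have int: "integrable M (continuation n f)"
    using assms(3) by (intro integrable_const_bound[of _ "real B"]) (auto simp: continuation_def)
  case 0
  then show ?case
    unfolding integral_cell_split[OF 0(1) int] cellsum.simps sum_distrib_left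
    by (intro sum.cong refl integral_continuation_cell) simp_all
next
  have int: "integrable M (continuation n f)"
    using assms(3) by (intro integrable_const_bound[of _ "real B"]) (auto simp: continuation_def)
  case (Suc k)
  show ?case
    unfolding integral_cell_split[OF Suc.prems(1) int] cellsum.simps sum_distrib_left
  proof (intro sum.cong refl)
    fix i :: nat assume "i \<in> {1,2,3}"
    then have "i # w \<in> lists {1,2,3}" using Suc.prems(1) by (simp only: Cons_in_lists_iff)
    then show "(LINT x:cell (i # w)|M. continuation n f x)
        = (1/3) ^ (n + 1) * cellsum k (\<lambda>x. real (f (psi_word w (psi i x))))"
      using Suc.IH[of "i # w"] Suc.prems(2) by simp
  qed
qed

text \<open>For \<open>n = Suc (length u) + k\<close> the cell consists of \<open>3 ^ k\<close>
  cells of level \<open>n\<close>, and \<open>8 * 3 ^ k / 3 ^ (n + 1)\<close> is \<open>8/3\<close>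
  times its measure. The bounded error of \<open>cellsum_id_conf\<close> is divided by
  \<open>3 ^ (n + 1)\<close>.\<close>

lemma id_conf_cell_limit_snoc:
  assumes "u \<in> lists {1,2,3}" "t \<in> {1,2,3}"
  shows "(\<lambda>j. LINT x:cell (u @ [t])|M. continuation (Suc j) (id_conf j) x)
    \<longlonglongrightarrow> 8/3 * measure M (cell (u @ [t]))"
proof -
  let ?w = "u @ [t]"
  let ?m = "Suc (length u)"
  have w: "?w \<in> lists {1,2,3}" using assms by (simp only: append_in_lists_conv Cons_in_lists_iff lists.Nil simp_thms)
  have "(\<lambda>k. (LINT x:cell ?w|M. continuation (Suc (k + length u)) (id_conf (k + length u)) x) - 8/3 * (1/3) ^ ?m) \<longlonglongrightarrow> 0"
  proof (rule Lim_null_comparison)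
    show "\<forall>\<^sub>F k in sequentially.
        norm ((LINT x:cell ?w|M. continuation (Suc (k + length u)) (id_conf (k + length u)) x) - 8/3 * (1/3) ^ ?m)
          \<le> 4 * (1/3) ^ k"
    proof (intro always_eventually allI)
      fix k
      let ?S = "cellsum k (\<lambda>x. real (id_conf (k + length u) (psi_word ?w x)))"
      have "(LINT x:cell ?w|M. continuation (Suc (k + length u)) (id_conf (k + length u)) x) = (1/3) ^ (k + ?m + 1) * ?S"
        using integral_continuation_cellsum[OF w, of k "Suc (k + length u)" "id_conf (k + length u)" 3]
          id_conf_bounds(2)[of "k + length u"] by simp
      also have "\<dots> - 8/3 * (1/3) ^ ?m = (1/3) ^ (k + ?m + 1) * (?S - 8 * 3 ^ k)"
        by (simp add: power_add field_simps)
      also have "norm \<dots> \<le> (1/3) ^ (k + ?m + 1) * 4"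
        unfolding norm_mult using cellsum_id_conf[OF assms add.commute, of k] by (intro mult_mono) auto
      also have "\<dots> \<le> (1/3) ^ k * 4" by (intro mult_right_mono power_decreasing) auto
      finally show "norm ((LINT x:cell ?w|M. continuation (Suc (k + length u)) (id_conf (k + length u)) x) - 8/3 * (1/3) ^ ?m)
          \<le> 4 * (1/3) ^ k" by simp
    qed
    show "(\<lambda>k. 4 * (1/3) ^ k :: real) \<longlonglongrightarrow> 0"
      by (intro tendsto_mult_right_zero LIMSEQ_realpow_zero) auto
  qed
  then have "(\<lambda>k. LINT x:cell ?w|M. continuation (Suc (k + length u)) (id_conf (k + length u)) x) \<longlonglongrightarrow> 8/3 * (1/3) ^ ?m"
    by (rule LIM_zero_cancel)
  then have "(\<lambda>j. LINT x:cell ?w|M. continuation (Suc j) (id_conf j) x) \<longlonglongrightarrow> 8/3 * (1/3) ^ ?m"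
    by (rule LIMSEQ_offset)
  then show ?thesis unfolding measure_cell[OF w] by simp
qed

lemma integrable_id_conf: "integrable M (continuation n (id_conf j))"
  using id_conf_bounds(2) by (intro integrable_const_bound[of _ 3]) (auto simp: continuation_def)

text \<open>The whole gasket mixes three orientations, so the empty word is first split into the
  level-one cells.\<close>

lemma id_conf_cell_limit:
  assumes "w \<in> lists {1,2,3}"
  shows "(\<lambda>j. LINT x:cell w|M. continuation (Suc j) (id_conf j) x) \<longlonglongrightarrow> 8/3 * measure M (cell w)"
proof (cases w rule: rev_cases)
  case Nil
  have "(\<lambda>j. \<Sum>i\<in>{1,2,3}. LINT x:cell [i]|M. continuation (Suc j) (id_conf j) x)
      \<longlonglongrightarrow> (\<Sum>i\<in>{1,2,3}. 8/3 * measure M (cell [i]))"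
  proof (rule tendsto_sum)
    fix i :: nat assume "i \<in> {1,2,3}"
    then show "(\<lambda>j. LINT x:cell [i]|M. continuation (Suc j) (id_conf j) x) \<longlonglongrightarrow> 8/3 * measure M (cell [i])"
      using id_conf_cell_limit_snoc[OF lists.Nil] unfolding append_Nil by blast
  qed
  moreover have "(\<Sum>i\<in>{1,2,3}. 8/3 * measure M (cell [i])) = 8/3 * measure M (cell [])"
    using measure_cell[of "[1]"] measure_cell[of "[2]"] measure_cell[of "[3]"] measure_cell[of "[]"]
    by (simp del: psi_word_Cons psi_word_Nil)
  ultimately show ?thesis
    unfolding Nil integral_cell_split[OF lists.Nil integrable_id_conf] by metis
next
  case (snoc u t)
  then have "u \<in> lists {1,2,3}" "t \<in> {1,2,3}"
    using assms by (simp_all only: append_in_lists_conv Cons_in_lists_iff)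
  then show ?thesis unfolding snoc by (rule id_conf_cell_limit_snoc)
qed

lemma SG_id_limit:
  assumes "C \<in> sets M"
  shows "(\<lambda>n. LINT x:C|M. continuation n (SG_id n) x) \<longlonglongrightarrow> 8/3 * measure M C"
proof -
  have "(\<lambda>j. LINT x:C|M. continuation (Suc j) (id_conf j) x) \<longlonglongrightarrow> 8/3 * measure M C"
  proof (rule tendsto_integral_of_cells)
    show "\<bar>continuation (Suc j) (id_conf j) x\<bar> \<le> 3" for j x
      using id_conf_bounds(2)[of j] by (simp add: continuation_def)
  qed (use assms id_conf_cell_limit in auto)
  then show ?thesis unfolding SG_id_eq[symmetric] by (rule LIMSEQ_imp_Suc)
qed

end

theorem theorem1p1:
  shows "weak_star_converges SG_measure (\<lambda>n. continuation n (SG_id n)) (\<lambda>x. 8 / 3) \<and>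
         (\<forall>C\<in>sets SG_measure.
            (\<lambda>n. set_lebesgue_integral SG_measure C (continuation n (SG_id n)))
              \<longlonglongrightarrow> 8 / 3 * measure SG_measure C)"
proof -
  have fin: "emeasure SG_measure SG \<noteq> \<infinity>" if "gasket_measure SG_measure"
  proof -
    interpret gasket_measure SG_measure by (rule that)
    show ?thesis by simp
  qed
  have const: "set_lebesgue_integral SG_measure C (\<lambda>x. 8 / 3) = 8 / 3 * measure SG_measure C"
    if C: "C \<in> sets SG_measure" for C
  proof -
    have "emeasure SG_measure C \<le> emeasure SG_measure SG"
      using emeasure_space[of SG_measure C] unfolding SG_measure_space .
    then have "emeasure SG_measure C \<noteq> \<infinity>" using SG_measure_cases fin by (auto simp: top_unique)
    from set_integral_const[OF C this, of "8 / 3 :: real"] show ?thesis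
      by (simp only: real_scaleR_def mult.commute)
  qed
  have limit: "(\<lambda>n. set_lebesgue_integral SG_measure C (continuation n (SG_id n)))
      \<longlonglongrightarrow> 8 / 3 * measure SG_measure C" if C: "C \<in> sets SG_measure" for C
    using SG_measure_cases
  proof
    assume "gasket_measure SG_measure"
    then show ?thesis using C by (rule gasket_measure.SG_id_limit)
  next
    assume null: "emeasure SG_measure SG = 0"
    have "SG \<in> null_sets SG_measure"
      using null sets.top[of SG_measure] unfolding SG_measure_space by (rule null_setsI)
    then have AE: "AE x in SG_measure. P x" for P
      using AE_not_in[of SG SG_measure] AE_space[of SG_measure] unfolding SG_measure_space
      by (auto elim: eventually_elim2)
    have "set_lebesgue_integral SG_measure C f = 0" for f :: "real \<times> real \<Rightarrow> real"
      unfolding set_lebesgue_integral_def by (rule integral_eq_zero_AE) (rule AE)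
    then show ?thesis unfolding const[OF C, symmetric] by (simp only: tendsto_const)
  qed
  show ?thesis unfolding weak_star_converges_def by (intro conjI ballI; simp only: const limit)
qed

end
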